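(* Let $\mathcal{X},\mathcal{Y}$ be finite alphabets, $\{P_\theta(y|x),\ x\in\mathcal{X},\ y\in\mathcal{Y},\ \theta\in\Theta\}$ a family of discrete memoryless channels, $R\ge 0$ a coding rate and $T\ge 0$ a threshold. Let $E_1(R,T,\theta)$, $K_n(\mathcal{C})$ and the decoder $\hat{\mathcal{R}}$ (the last two depending on a parameter $\xi$), and the number $\xi^*(R,T)$, be as defined in the context. Consider the ensemble of codes $\mathcal{C}$ of length $n$ with $M=e^{nR}$ codewords, where each codeword is drawn independently under the uniform distribution $Q(\boldsymbol{x})=1/|\mathcal{X}|^n$ for all $\boldsymbol{x}\in\mathcal{X}^n$, and let $\bar K_n=\boldsymbol{E}\{K_n(\mathcal{C})\}$ be the average over this ensemble. Then: 1. For every $\xi\le\xi^*(R,T)$ (where $K_n$ is defined with this $\xi$), $$\limsup_{n\to\infty}\frac1n\log\bar K_n\le 0.$$ 2. For $\xi=\xi^*(R,T)$, the average probability of $\mathcal{E}_1$ and the average probability of $\mathcal{E}_2$, associated with the decoder $\hat{\mathcal{R}}$, decay with exponential rates at least as large as $\xi^*(R,T)\cdot E_1(R,T,\theta)$ and $\xi^*(R,T)\cdot E_1(R,T,\theta)+T$, respectively, for all $\theta\in\Theta$.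
   Context: Channels: for each $\theta\in\Theta$, $P_\theta(\cdot|x)$ is a probability distribution on $\mathcal{Y}$ for every $x\in\mathcal{X}$, and for $\boldsymbol{x}\in\mathcal{X}^n$, $\boldsymbol{y}\in\mathcal{Y}^n$, $P_\theta(\boldsymbol{y}|\boldsymbol{x})=\prod_{i=1}^n P_\theta(y_i|x_i)$. Entropies are in natural units. Codes and erasure decoders: a rate-$R$ code is $\mathcal{C}=\{\boldsymbol{x}_1,\ldots,\boldsymbol{x}_M\}$, $\boldsymbol{x}_m\in\mathcal{X}^n$, $M=e^{nR}$, with equiprobable messages. A decoder with an erasure option is a partition $\mathcal{R}=(\mathcal{R}_0,\mathcal{R}_1,\ldots,\mathcal{R}_M)$ of $\mathcal{Y}^n$: decide message $m$ if $\boldsymbol{y}\in\mathcal{R}_m$, $m\ge1$, and declare an erasure if $\boldsymbol{y}\in\mathcal{R}_0$. Let $\mathcal{E}_1$ be the event of not making the right decision and $\mathcal{E}_2$ the event of undetected error (making the wrong decision). Under channel $\theta$ their probabilities are $$\Pr\{\mathcal{E}_1\}=\frac1M\sum_{m=1}^M\sum_{\boldsymbol{y}\in\mathcal{R}_m^c}P_\theta(\boldsymbol{y}|\boldsymbol{x}_m),\qquad \Pr\{\mathcal{E}_2\}=\frac1M\sum_{m=1}^M\sum_{\boldsymbol{y}\in\mathcal{R}_m}\sum_{m'\ne m}P_\theta(\boldsymbol{y}|\boldsymbol{x}_{m'}).$$ Their average probabilities are the expectations of these quantities over the random code. The Lagrangian is $\Gamma_\theta(\mathcal{C},\mathcal{R})=\Pr\{\mathcal{E}_2\}+e^{-nT}\Pr\{\mathcal{E}_1\}$.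 Forney's exponent for channel $\theta$: $$E_1(R,T,\theta)=\max_{0\le s\le\rho\le1}\max_Q\,[E_0(s,\rho,Q,\theta)-\rho R-sT],$$ $$E_0(s,\rho,Q,\theta)=-\ln\left[\sum_{y\in\mathcal{Y}}\Big(\sum_{x\in\mathcal{X}}Q(x)P_\theta^{1-s}(y|x)\Big)\Big(\sum_{x'\in\mathcal{X}}Q(x')P_\theta^{s/\rho}(y|x')\Big)^{\rho}\right],$$ where $Q$ ranges over probability distributions on $\mathcal{X}$. Competitive minimax criterion, for a given constant $\xi\in(0,1]$: $$K_n(\mathcal{C})=\min_{\mathcal{R}}\max_{\theta\in\Theta}\frac{\Gamma_\theta(\mathcal{C},\mathcal{R})}{e^{-n[\xi E_1(R,T,\theta)+T]}},$$ the minimum being over all decoders with an erasure option. Universal decoder $\hat{\mathcal{R}}$ for a given $\xi$: with $$f(\boldsymbol{x},\boldsymbol{y})=\max_{\theta\in\Theta}\left\{e^{n[\xi E_1(R,T,\theta)+T]}P_\theta(\boldsymbol{y}|\boldsymbol{x})\right\},$$ set $$\hat{\mathcal{R}}_m=\left\{\boldsymbol{y}:\ \frac{f(\boldsymbol{x}_m,\boldsymbol{y})}{\sum_{m'\ne m}f(\boldsymbol{x}_{m'},\boldsymbol{y})}\ge e^{nT}\right\},\quad m=1,\ldots,M,\qquad \hat{\mathcal{R}}_0=\bigcap_{m=1}^M\hat{\mathcal{R}}_m^c.$$ Definition of $\xi^*(R,T)$: for a distribution $P_y$ on $\mathcal{Y}$, a real $\lambda\ge 0$ and $\theta\in\Theta$,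 let $$F(P_y,\lambda,\theta)=\ln|\mathcal{X}|-\max_{P_{x|y}}\left[H(X|Y)+\lambda\boldsymbol{E}\ln P_\theta(Y|X)\right],$$ where $(X,Y)$ has joint distribution $P_y(y)P_{x|y}(x|y)$, and $\boldsymbol{E}$ and $H(X|Y)$ are expectation and conditional entropy under it. For $\theta,\tilde\theta\in\Theta$ and $0\le s\le\rho\le1$, let $$E(\theta,\tilde\theta,s,\rho)=\min_{P_y}\left[F(P_y,1-s,\theta)+\rho F(P_y,s/\rho,\tilde\theta)-H(Y)\right],$$ where $H(Y)$ is the entropy of $Y$ induced by $P_y$. Then $$\xi^*(R,T)=\min_{\theta,\tilde\theta}\ \max_{0\le s\le\rho\le1}\frac{E(\theta,\tilde\theta,s,\rho)-\rho R-sT}{(1-s)E_1(R,T,\theta)+sE_1(R,T,\tilde\theta)},$$ with the convention that if the denominator vanishes, then $\xi^*(R,T)=1$.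
   Formalization: The convention for a vanishing denominator in ξ* is applied to the quotient: it counts as 1 only if the numerator is nonnegative, and as −∞ if negative (s=ρ=1, E_1(θ̃)=0<E_1(θ)); with 1 there the claim fails, e.g. for a BSC plus a useless channel, R_crit<R<C, small T>0. *)

theory Defs
  imports "HOL-Probability.Probability"
begin

text \<open>
  A family of discrete memoryless channels is a function \<open>P :: 't \<Rightarrow> 'x \<Rightarrow> 'y pmf\<close> with finite
  alphabets \<open>'x\<close>, \<open>'y\<close>, restricted to an index set \<open>\<Theta> :: 't set\<close>; \<open>pmf (P \<theta> x) y\<close> is
  $P_\theta(y|x)$. No finiteness of \<open>\<Theta>\<close> is assumed, so maxima and minima over parameters are
  rendered as suprema and infima. The real-valued ones below all range over bounded sets.
\<close>

text \<open>Real powers with $0^0 = 1$ (whereas \<open>0 powr 0 = 0\<close>).\<close>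

definition rpow :: "real \<Rightarrow> real \<Rightarrow> real" where
  "rpow a b = (if b = 0 then 1 else a powr b)"

text \<open>Natural logarithm on the nonnegative reals with $\ln 0 = -\infty$.\<close>

definition eln :: "real \<Rightarrow> ereal" where
  "eln a = (if a \<le> 0 then -\<infinity> else ereal (ln a))"


section \<open>Codes and erasure decoders\<close>

definition words :: "nat \<Rightarrow> 'a list set" where
  "words n = {x. length x = n}"

definition block_prob :: "('t \<Rightarrow> 'x \<Rightarrow> 'y pmf) \<Rightarrow> 't \<Rightarrow> 'x list \<Rightarrow> 'y list \<Rightarrow> real" where
  "block_prob P \<theta> x y = (\<Prod>i<length x. pmf (P \<theta> (x ! i)) (y ! i))"

text \<open>
  A code is the list of its codewords; message \<open>m \<in> {1..M}\<close> is sent as \<open>codeword C m\<close>.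
  A decoder is given by its regions \<open>Reg 0\<close> (erasure), \<open>Reg 1\<close>, \dots, \<open>Reg M\<close>, some of which may be
  empty.
\<close>

abbreviation codeword :: "'x list list \<Rightarrow> nat \<Rightarrow> 'x list" where
  "codeword C m \<equiv> C ! (m - 1)"

definition erasure_decoders :: "nat \<Rightarrow> nat \<Rightarrow> (nat \<Rightarrow> 'y list set) set" where
  "erasure_decoders n M =
     {Reg. (\<Union>m\<in>{0..M}. Reg m) = words n \<and> disjoint_family_on Reg {0..M}}"

definition prob_E1 ::
  "('t \<Rightarrow> 'x \<Rightarrow> 'y pmf) \<Rightarrow> 't \<Rightarrow> nat \<Rightarrow> 'x list list \<Rightarrow> (nat \<Rightarrow> 'y list set) \<Rightarrow> real" where
  "prob_E1 P \<theta> n C Reg =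
     1 / real (length C) *
     (\<Sum>m\<in>{1..length C}. \<Sum>y\<in>words n - Reg m. block_prob P \<theta> (codeword C m) y)"

definition prob_E2 ::
  "('t \<Rightarrow> 'x \<Rightarrow> 'y pmf) \<Rightarrow> 't \<Rightarrow> nat \<Rightarrow> 'x list list \<Rightarrow> (nat \<Rightarrow> 'y list set) \<Rightarrow> real" where
  "prob_E2 P \<theta> n C Reg =
     1 / real (length C) *
     (\<Sum>m\<in>{1..length C}. \<Sum>y\<in>words n \<inter> Reg m.
        \<Sum>m'\<in>{1..length C} - {m}. block_prob P \<theta> (codeword C m') y)"

definition Lagrangian ::
  "('t \<Rightarrow> 'x \<Rightarrow> 'y pmf) \<Rightarrow> real \<Rightarrow> 't \<Rightarrow> nat \<Rightarrow> 'x list list \<Rightarrow> (nat \<Rightarrow> 'y list set) \<Rightarrow> real" where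
  "Lagrangian P T \<theta> n C Reg =
     prob_E2 P \<theta> n C Reg + exp (- real n * T) * prob_E1 P \<theta> n C Reg"


section \<open>Forney's exponent\<close>

text \<open>
  At \<open>\<rho> = 0\<close> (hence \<open>s = 0\<close>) the second factor is $(\cdot)^0 = 1$, whatever value \<open>s / \<rho>\<close> has.
\<close>

definition E0 ::
  "('t \<Rightarrow> 'x::finite \<Rightarrow> 'y::finite pmf) \<Rightarrow> real \<Rightarrow> real \<Rightarrow> 'x pmf \<Rightarrow> 't \<Rightarrow> real" where
  "E0 P s \<rho> Q \<theta> =
     - ln (\<Sum>y\<in>UNIV. (\<Sum>x\<in>UNIV. pmf Q x * rpow (pmf (P \<theta> x) y) (1 - s))
             * rpow (\<Sum>x'\<in>UNIV. pmf Q x' * rpow (pmf (P \<theta> x') y) (s / \<rho>)) \<rho>)"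

definition s_rho_range :: "(real \<times> real) set" where
  "s_rho_range = {(s, \<rho>). 0 \<le> s \<and> s \<le> \<rho> \<and> \<rho> \<le> 1}"

text \<open>
  The supremum is finite: by choosing \<open>x\<close> with $Q(x) \ge 1/|X|$ and then \<open>y\<close> with
  $P_\theta(y|x) \ge 1/|Y|$ one sees that \<open>E0\<close> is at most $2 \ln(|X||Y|)$.
\<close>

definition E1 ::
  "('t \<Rightarrow> 'x::finite \<Rightarrow> 'y::finite pmf) \<Rightarrow> real \<Rightarrow> real \<Rightarrow> 't \<Rightarrow> real" where
  "E1 P R T \<theta> =
     (SUP ((s, \<rho>), Q)\<in>s_rho_range \<times> UNIV. E0 P s \<rho> Q \<theta> - \<rho> * R - s * T)"


section \<open>Competitive minimax criterion and universal decoder\<close>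

definition K ::
  "('t \<Rightarrow> 'x::finite \<Rightarrow> 'y::finite pmf) \<Rightarrow> 't set \<Rightarrow> real \<Rightarrow> real \<Rightarrow> real \<Rightarrow> nat \<Rightarrow> 'x list list \<Rightarrow> real"
  where
  "K P \<Theta> R T \<xi> n C =
     (INF Reg\<in>erasure_decoders n (length C).
        SUP \<theta>\<in>\<Theta>. Lagrangian P T \<theta> n C Reg / exp (- real n * (\<xi> * E1 P R T \<theta> + T)))"

definition score ::
  "('t \<Rightarrow> 'x::finite \<Rightarrow> 'y::finite pmf) \<Rightarrow> 't set \<Rightarrow> real \<Rightarrow> real \<Rightarrow> real \<Rightarrow> nat \<Rightarrow>
     'x list \<Rightarrow> 'y list \<Rightarrow> real" where
  "score P \<Theta> R T \<xi> n x y =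
     (SUP \<theta>\<in>\<Theta>. exp (real n * (\<xi> * E1 P R T \<theta> + T)) * block_prob P \<theta> x y)"

text \<open>
  The quotient is taken in \<^typ>\<open>ereal\<close>, so that it is \<open>\<infinity>\<close> if only the denominator vanishes (for
  instance if there is just one codeword); the quotient $0/0$ is \<open>0\<close>, leading to an erasure.
\<close>

definition universal_region ::
  "('t \<Rightarrow> 'x::finite \<Rightarrow> 'y::finite pmf) \<Rightarrow> 't set \<Rightarrow> real \<Rightarrow> real \<Rightarrow> real \<Rightarrow> nat \<Rightarrow>
     'x list list \<Rightarrow> nat \<Rightarrow> 'y list set" where
  "universal_region P \<Theta> R T \<xi> n C m =
     {y \<in> words n.
        ereal (score P \<Theta> R T \<xi> n (codeword C m) y) /
        ereal (\<Sum>m'\<in>{1..length C} - {m}. score P \<Theta> R T \<xi> n (codeword C m') y)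
        \<ge> ereal (exp (real n * T))}"

definition universal_decoder ::
  "('t \<Rightarrow> 'x::finite \<Rightarrow> 'y::finite pmf) \<Rightarrow> 't set \<Rightarrow> real \<Rightarrow> real \<Rightarrow> real \<Rightarrow> nat \<Rightarrow>
     'x list list \<Rightarrow> nat \<Rightarrow> 'y list set" where
  "universal_decoder P \<Theta> R T \<xi> n C m =
     (if m = 0 then words n - (\<Union>k\<in>{1..length C}. universal_region P \<Theta> R T \<xi> n C k)
      else universal_region P \<Theta> R T \<xi> n C m)"


section \<open>The constant $\xi^*(R,T)$\<close>

definition entropy_pmf :: "'a::finite pmf \<Rightarrow> real" where
  "entropy_pmf p = - (\<Sum>a\<in>UNIV. pmf p a * ln (pmf p a))"

definition cond_entropy :: "'y::finite pmf \<Rightarrow> ('y \<Rightarrow> 'x::finite pmf) \<Rightarrow> real" where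
  "cond_entropy Py W = (\<Sum>y\<in>UNIV. pmf Py y * entropy_pmf (W y))"

text \<open>
  \<open>W y\<close> is $P_{x|y}(\cdot|y)$. In \<^typ>\<open>ereal\<close> one has $0 \cdot (-\infty) = 0$, so only pairs of positive
  probability contribute to the expectation, and \<open>lam = 0\<close> (the parameter $\lambda$ of $F$) removes it;
  this agrees with \<open>rpow\<close>.
\<close>

definition expected_log ::
  "('t \<Rightarrow> 'x::finite \<Rightarrow> 'y::finite pmf) \<Rightarrow> 't \<Rightarrow> 'y pmf \<Rightarrow> ('y \<Rightarrow> 'x pmf) \<Rightarrow> ereal" where
  "expected_log P \<theta> Py W =
     (\<Sum>y\<in>UNIV. \<Sum>x\<in>UNIV. ereal (pmf Py y * pmf (W y) x) * eln (pmf (P \<theta> x) y))"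

definition F_fun ::
  "('t \<Rightarrow> 'x::finite \<Rightarrow> 'y::finite pmf) \<Rightarrow> 'y pmf \<Rightarrow> real \<Rightarrow> 't \<Rightarrow> ereal" where
  "F_fun P Py lam \<theta> =
     ereal (ln (real CARD('x))) -
     (SUP W\<in>UNIV. ereal (cond_entropy Py W) + ereal lam * expected_log P \<theta> Py W)"

definition E_pair ::
  "('t \<Rightarrow> 'x::finite \<Rightarrow> 'y::finite pmf) \<Rightarrow> 't \<Rightarrow> 't \<Rightarrow> real \<Rightarrow> real \<Rightarrow> ereal" where
  "E_pair P \<theta> \<theta>' s \<rho> =
     (INF Py\<in>UNIV. F_fun P Py (1 - s) \<theta> + ereal \<rho> * F_fun P Py (s / \<rho>) \<theta>' - ereal (entropy_pmf Py))"

text \<open>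
  A quotient with vanishing denominator counts as 1, except that it is $-\infty$ if its numerator is
  negative. The exception matters only at \<open>s = \<rho> = 1\<close>, where the numerator is $-R-T$: if
  $E_1(R,T,\tilde\theta) = 0 < E_1(R,T,\theta)$, the value 1 there would be a spurious maximum over
  \<open>(s, \<rho>)\<close>: for strictly positive channels with $R + T > 0$ the quotient tends to $-\infty$ as \<open>s\<close>
  tends to 1. For
  \<open>s = \<rho> = 0\<close> the numerator is 0, so a pair with $E_1(R,T,\theta) = 0$ has maximum at least 1.
\<close>

definition exponent_ratio :: "ereal \<Rightarrow> real \<Rightarrow> ereal" where
  "exponent_ratio a b = (if b = 0 \<and> 0 \<le> a then 1 else a / ereal b)"

text \<open>
  The infimum lies in $[0,1]$ for nonempty \<open>\<Theta>\<close>: \<open>s = \<rho> = 0\<close> yields at least 0, and the pairs with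
  $\theta = \tilde\theta$ yield at most 1.
\<close>

definition xi_star ::
  "('t \<Rightarrow> 'x::finite \<Rightarrow> 'y::finite pmf) \<Rightarrow> 't set \<Rightarrow> real \<Rightarrow> real \<Rightarrow> real" where
  "xi_star P \<Theta> R T = real_of_ereal
     (INF (\<theta>, \<theta>')\<in>\<Theta> \<times> \<Theta>. SUP (s, \<rho>)\<in>s_rho_range.
        exponent_ratio (E_pair P \<theta> \<theta>' s \<rho> - ereal (\<rho> * R) - ereal (s * T))
          ((1 - s) * E1 P R T \<theta> + s * E1 P R T \<theta>'))"


section \<open>Random coding ensemble\<close>

text \<open>Since $e^{nR}$ need not be an integer, it is rounded up.\<close>

definition num_messages :: "real \<Rightarrow> nat \<Rightarrow> nat" where
  "num_messages R n = nat \<lceil>exp (real n * R)\<rceil>"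

definition code_ensemble :: "real \<Rightarrow> nat \<Rightarrow> 'x::finite list list pmf" where
  "code_ensemble R n = replicate_pmf (num_messages R n) (pmf_of_set (words n))"

definition code_average :: "real \<Rightarrow> nat \<Rightarrow> ('x::finite list list \<Rightarrow> real) \<Rightarrow> real" where
  "code_average R n g = measure_pmf.expectation (code_ensemble R n) g"

definition log_rate :: "(nat \<Rightarrow> real) \<Rightarrow> nat \<Rightarrow> ereal" where
  "log_rate a n = ereal (1 / real n) * eln (a n)"

end

theory Submission
  imports Defs "HOL-Real_Asymp.Real_Asymp"
begin

text \<open>
  For a code with scores $f(x_m, y)$ the universal decoder minimises
  $\frac1M \sum_m \sum_y \min(e^{-nT} f(x_m, y), \sum_{m' \ne m} f(x_{m'}, y))$ termwise, and this minimal
  risk dominates $e^{n[\xi E_1(\theta) + T]} \Gamma_\theta$ for every $\theta$ at once. As the likelihood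
  depends on the joint type only, $f$ is at most twice a sum of weighted likelihoods over polynomially
  many parameters, so it suffices to average $\min(a P_\theta(y|x_m), b \sum_{m'} P_{\theta'}(y|x_{m'}))$ for
  each pair $(\theta, \theta')$. With $\min(u, v) \le u^{1-s} v^s$,
  $(\sum_i p_i)^s \le (\sum_i p_i^{s/\rho})^\rho$ and Jensen's inequality, the uniform ensemble gives the
  $n$-th power of the single-letter sum
  $\sum_y A_\theta(y) B_{\theta'}(y)^\rho$, where $A_\theta(y)$ and $B_{\theta'}(y)$ are the averages over $x$
  of $P_\theta(y|x)^{1-s}$ and $P_{\theta'}(y|x)^{s/\rho}$. By the Gibbs variational principle its negative
  logarithm is $E(\theta, \theta', s, \rho)$, and the definition of $\xi^*$ makes some choice of
  $(s, \rho)$ cancel the weights up to $e^{n\epsilon}$.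
\<close>

section \<open>Powers, expectations and random codes\<close>

lemma rpow_nonneg [simp]: "0 \<le> rpow a b"
  by (simp add: rpow_def)

lemma rpow_0 [simp]: "rpow a 0 = 1"
  by (simp add: rpow_def)

lemma rpow_1 [simp]: "0 \<le> a \<Longrightarrow> rpow a 1 = a"
  by (simp add: rpow_def)

lemma rpow_mult: "0 \<le> a \<Longrightarrow> 0 \<le> b \<Longrightarrow> rpow (a * b) c = rpow a c * rpow b c"
  by (simp add: rpow_def powr_mult)

lemma rpow_prod: "(\<And>i. i \<in> I \<Longrightarrow> 0 \<le> f i) \<Longrightarrow> rpow (\<Prod>i\<in>I. f i) c = (\<Prod>i\<in>I. rpow (f i) c)"
proof (induction I rule: infinite_finite_induct)
  case (insert x F)
  then show ?case by (simp add: rpow_mult prod_nonneg)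
qed (simp_all add: rpow_def)

lemma rpow_mono: "0 \<le> a \<Longrightarrow> a \<le> b \<Longrightarrow> 0 \<le> c \<Longrightarrow> rpow a c \<le> rpow b c"
  by (simp add: rpow_def powr_mono2)

lemma le_rpow: "0 \<le> a \<Longrightarrow> a \<le> 1 \<Longrightarrow> 0 \<le> c \<Longrightarrow> c \<le> 1 \<Longrightarrow> a \<le> rpow a c"
  using powr_mono'[of c 1 a] by (cases "a = 0") (auto simp: rpow_def)

text \<open>The minimum is the product of its own powers with exponents \<open>1 - s\<close> and
  \<open>s\<close>, and each factor grows when its base is replaced by \<open>a\<close> or by
  \<open>b\<close>. If one of these is 0, so is the minimum.\<close>

lemma min_le_rpow_mult:
  assumes "0 \<le> a" "0 \<le> b" "0 \<le> s" "s \<le> 1"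
  shows "min a b \<le> rpow a (1 - s) * rpow b s"
proof (cases "a = 0 \<or> b = 0")
  case True
  then show ?thesis using assms by (auto simp: min_def)
next
  case False
  define c where "c = min a b"
  have "c > 0" "c \<le> a" "c \<le> b" using False assms by (auto simp: c_def)
  then have "c = rpow c (1 - s) * rpow c s"
    by (simp add: rpow_def powr_add [symmetric])
  also have "\<dots> \<le> rpow a (1 - s) * rpow b s"
    using \<open>c > 0\<close> \<open>c \<le> a\<close> \<open>c \<le> b\<close> assms by (intro mult_mono rpow_mono) auto
  finally show ?thesis by (simp add: c_def)
qed

text \<open>Subadditivity of concave powers. It turns a power of the sum over rival codewords into a
  sum of powers, whose expectation is linear.\<close>

lemma powr_sum_list_le:
  fixes f :: "'a \<Rightarrow> real"
  assumes "\<And>x. x \<in> set xs \<Longrightarrow> 0 \<le> f x" "0 < t" "t \<le> 1"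
  shows "sum_list (map f xs) powr t \<le> (\<Sum>x\<leftarrow>xs. f x powr t)"
  using assms(1)
proof (induction xs)
  case (Cons x xs)
  have sub: "(a + b) powr t \<le> a powr t + b powr t" if "0 \<le> a" "0 \<le> b" for a b :: real
  proof (cases "a + b = 0")
    case True
    then show ?thesis using that assms by simp
  next
    case False
    with that have pos: "a + b > 0" by simp
    \<comment> \<open>After normalisation both summands lie in [0, 1], where a power with exponent
      at most 1 is at least its base.\<close>
    have "1 = a / (a + b) + b / (a + b)" using pos by (simp add: add_divide_distrib [symmetric])
    also have "\<dots> \<le> (a / (a + b)) powr t + (b / (a + b)) powr t"
      using that pos assms le_rpow[of "a / (a + b)" t] le_rpow[of "b / (a + b)" t]
      by (intro add_mono) (auto simp: rpow_def)
    finally show ?thesis using that pos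
      by (simp add: powr_divide add_divide_distrib [symmetric] le_divide_eq)
  qed
  have "0 \<le> sum_list (map f xs)" using Cons.prems by (intro sum_list_nonneg) auto
  then have "(f x + sum_list (map f xs)) powr t \<le> f x powr t + sum_list (map f xs) powr t"
    using Cons.prems by (intro sub) auto
  also have "\<dots> \<le> f x powr t + (\<Sum>x\<leftarrow>xs. f x powr t)"
    using Cons by auto
  finally show ?case by simp
qed simp

section \<open>Expectations over finitely supported distributions and over random codes\<close>

lemma expectation_mono_finite:
  fixes f g :: "'a \<Rightarrow> real"
  assumes "finite (set_pmf p)" "\<And>x. x \<in> set_pmf p \<Longrightarrow> f x \<le> g x"
  shows "measure_pmf.expectation p f \<le> measure_pmf.expectation p g"
  using assms by (intro integral_mono_AE integrable_measure_pmf_finite) (auto simp: AE_measure_pmf_iff)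

text \<open>Young's inequality provides the tangent of $t^r$ at the mean, and with it Jensen's inequality.\<close>

lemma expectation_powr_le:
  fixes f :: "'a \<Rightarrow> real"
  assumes fin: "finite (set_pmf p)" and nn: "\<And>x. x \<in> set_pmf p \<Longrightarrow> 0 \<le> f x"
    and r: "0 < r" "r \<le> 1"
  shows "measure_pmf.expectation p (\<lambda>x. f x powr r) \<le> measure_pmf.expectation p f powr r"
proof (cases "measure_pmf.expectation p f = 0")
  case True
  \<comment> \<open>The tangent argument needs a positive mean; a nonnegative \<open>f\<close> with
    mean 0 vanishes on the support.\<close>
  have "AE x in measure_pmf p. f x = 0"
    using True nn integral_nonneg_eq_0_iff_AE[of "measure_pmf p" f]
    by (auto simp: AE_measure_pmf_iff integrable_measure_pmf_finite fin)
  then have "measure_pmf.expectation p (\<lambda>x. f x powr r) = measure_pmf.expectation p (\<lambda>x. 0)"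
    by (intro integral_cong_AE) auto
  then show ?thesis using True by simp
next
  case False
  define a where "a = measure_pmf.expectation p f"
  have "0 \<le> a" unfolding a_def using nn by (intro integral_nonneg_AE) (auto simp: AE_measure_pmf_iff)
  with False have a: "0 < a" by (simp add: a_def)
  have int: "integrable (measure_pmf p) g" for g :: "'a \<Rightarrow> real"
    by (rule integrable_measure_pmf_finite [OF fin])
  \<comment> \<open>The factor \<open>a powr (1 - r)\<close> completes the product for Young's
    inequality and is cancelled at the end.\<close>
  have "measure_pmf.expectation p (\<lambda>x. f x powr r) * a powr (1 - r)
      = measure_pmf.expectation p (\<lambda>x. f x powr r * a powr (1 - r))"
    by simp
  also have "\<dots> \<le> measure_pmf.expectation p (\<lambda>x. r * f x + (1 - r) * a)"
  proof (intro expectation_mono_finite fin)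
    fix x assume "x \<in> set_pmf p"
    then show "f x powr r * a powr (1 - r) \<le> r * f x + (1 - r) * a"
      using nn[of x] r a Youngs_inequality_0[of r "1 - r" "f x" a] by (cases "f x = 0") auto
  qed
  also have "\<dots> = r * a + (1 - r) * a"
    by (simp add: a_def int)
  also have "\<dots> = a powr r * a powr (1 - r)"
    using a by (simp add: powr_add [symmetric] algebra_simps)
  finally show ?thesis using a by (simp add: a_def)
qed

lemma expectation_pair_mult:
  fixes f :: "'a \<Rightarrow> real" and g :: "'b \<Rightarrow> real"
  assumes "finite (set_pmf p)" "finite (set_pmf q)"
  shows "measure_pmf.expectation (pair_pmf p q) (\<lambda>z. f (fst z) * g (snd z)) =
    measure_pmf.expectation p f * measure_pmf.expectation q g"
proof -
  have "measure_pmf.expectation (pair_pmf p q) (\<lambda>z. f (fst z) * g (snd z)) =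
      (\<Sum>z\<in>set_pmf p \<times> set_pmf q. f (fst z) * g (snd z) * pmf (pair_pmf p q) z)"
    using assms by (intro integral_measure_pmf_real) auto
  also have "\<dots> = (\<Sum>x\<in>set_pmf p. \<Sum>y\<in>set_pmf q. (f x * pmf p x) * (g y * pmf q y))"
    by (auto simp: sum.cartesian_product pmf_pair mult_ac intro!: sum.cong)
  also have "\<dots> = measure_pmf.expectation p f * measure_pmf.expectation q g"
    using assms by (simp add: sum_product integral_measure_pmf_real[where A = "set_pmf p"]
        integral_measure_pmf_real[where A = "set_pmf q"])
  finally show ?thesis .
qed

lemma finite_set_replicate_pmf: "finite (set_pmf p) \<Longrightarrow> finite (set_pmf (replicate_pmf n p))"
  using finite_lists_length_eq[of "set_pmf p" n] by (simp add: set_replicate_pmf in_lists_conv_set subset_iff Ball_def)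

lemma expectation_replicate_sum_list:
  fixes f :: "'a \<Rightarrow> real"
  assumes fin: "finite (set_pmf p)"
  shows "measure_pmf.expectation (replicate_pmf n p) (\<lambda>xs. sum_list (map f xs)) =
    real n * measure_pmf.expectation p f"
proof (induction n)
  case (Suc n)
  have *: "replicate_pmf (Suc n) p = map_pmf (\<lambda>(x, xs). x # xs) (pair_pmf p (replicate_pmf n p))"
    by (simp add: pair_pmf_def map_bind_pmf)
  have int: "integrable (measure_pmf (pair_pmf p (replicate_pmf n p))) g" for g :: "_ \<Rightarrow> real"
    by (rule integrable_measure_pmf_finite) (simp add: fin finite_set_replicate_pmf)
  have "measure_pmf.expectation (replicate_pmf (Suc n) p) (\<lambda>xs. sum_list (map f xs)) =
      measure_pmf.expectation (pair_pmf p (replicate_pmf n p))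
        (\<lambda>z. f (fst z) + sum_list (map f (snd z)))"
    unfolding * by (simp add: case_prod_unfold)
  also have "\<dots> = measure_pmf.expectation p f + real n * measure_pmf.expectation p f"
    using expectation_pair_pmf_snd[of p "replicate_pmf n p" "\<lambda>xs. sum_list (map f xs)"]
    by (simp add: int Suc)
  finally show ?case by (simp add: algebra_simps)
qed simp

text \<open>The sent codeword is independent of its rivals, which form a random code with one word
  less: independent draws commute, so draw \<open>i\<close> can be moved to the front.\<close>

lemma replicate_pmf_split_nth:
  assumes "i < n"
  shows "map_pmf (\<lambda>xs. (xs ! i, take i xs @ drop (Suc i) xs)) (replicate_pmf n p) =
    pair_pmf p (replicate_pmf (n - 1) p)"
proof -
  obtain k where n: "n = i + Suc k" using assms less_imp_Suc_add by auto
  have "map_pmf (\<lambda>xs. (xs ! i, take i xs @ drop (Suc i) xs)) (replicate_pmf n p) =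
    do {xs \<leftarrow> replicate_pmf i p; x \<leftarrow> p; zs \<leftarrow> replicate_pmf k p;
        return_pmf ((xs @ x # zs) ! i, take i (xs @ x # zs) @ drop (Suc i) (xs @ x # zs))}"
    unfolding n replicate_pmf_distrib by (simp add: map_bind_pmf bind_assoc_pmf bind_return_pmf)
  also have "\<dots> = do {xs \<leftarrow> replicate_pmf i p; x \<leftarrow> p; zs \<leftarrow> replicate_pmf k p; return_pmf (x, xs @ zs)}"
    by (intro bind_pmf_cong refl) (auto simp: set_replicate_pmf nth_append)
  also have "\<dots> = pair_pmf p (replicate_pmf (i + k) p)"
    by (subst bind_commute_pmf)
      (simp add: pair_pmf_def replicate_pmf_distrib bind_assoc_pmf bind_return_pmf)
  finally show ?thesis by (simp add: n)
qed

text \<open>Here \<open>\<phi>\<close> and \<open>\<psi>\<close> stand for the likelihoods of the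
  sent codeword and of a rival under two parameters, \<open>a\<close> and \<open>b\<close> for their
  weights, and \<open>N\<close> for the nominal code size. The minimum becomes a product of powers,
  which independence separates; the rival factor is then treated by subadditivity and Jensen's
  inequality.\<close>

lemma random_coding_bound:
  fixes \<phi> \<psi> :: "'a \<Rightarrow> real"
  assumes fin: "finite (set_pmf p)" and nn: "\<And>x. 0 \<le> \<phi> x" "\<And>x. 0 \<le> \<psi> x"
    and i: "i < n" and ab: "0 < a" "0 < b" and s: "0 \<le> s" "s \<le> \<rho>" "\<rho> \<le> 1"
    and N: "1 \<le> N" "real n - 1 \<le> N"
  shows "measure_pmf.expectation (replicate_pmf n p)
      (\<lambda>C. min (a * \<phi> (C ! i)) (b * sum_list (map \<psi> (take i C @ drop (Suc i) C))))
    \<le> a powr (1 - s) * b powr s * measure_pmf.expectation p (\<lambda>x. rpow (\<phi> x) (1 - s)) *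
      (N powr \<rho> * rpow (measure_pmf.expectation p (\<lambda>x. rpow (\<psi> x) (s / \<rho>))) \<rho>)"
proof -
  define q where "q = replicate_pmf (n - 1) p"
  have finq: "finite (set_pmf q)" by (simp add: q_def fin finite_set_replicate_pmf)
  define S where "S xs = sum_list (map \<psi> xs)" for xs
  have S0: "0 \<le> S xs" for xs unfolding S_def by (intro sum_list_nonneg) (auto simp: nn)
  have rp: "rpow (c * z) t = c powr t * rpow z t" if "0 < c" "0 \<le> z" for c z t
    using that by (simp add: rpow_mult) (simp add: rpow_def)
  have S_bound: "measure_pmf.expectation q (\<lambda>xs. rpow (S xs) s)
      \<le> N powr \<rho> * rpow (measure_pmf.expectation p (\<lambda>x. rpow (\<psi> x) (s / \<rho>))) \<rho>"
  proof (cases "s = 0")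
    case True
    \<comment> \<open>The power with exponent 0 is 1 even if the rival sum vanishes, so that
      \<open>1 \<le> N\<close> is what carries this case.\<close>
    have "1 \<le> N powr \<rho>" using N s by (simp add: ge_one_powr_ge_zero)
    then show ?thesis using True N by (simp add: rpow_def)
  next
    case False
    then have sr: "0 < s" "0 < \<rho>" "0 < s / \<rho>" "s / \<rho> \<le> 1" using s by auto
    define e where "e = measure_pmf.expectation p (\<lambda>x. \<psi> x powr (s / \<rho>))"
    have "measure_pmf.expectation q (\<lambda>xs. rpow (S xs) s) \<le>
        measure_pmf.expectation q (\<lambda>xs. sum_list (map (\<lambda>x. \<psi> x powr (s / \<rho>)) xs) powr \<rho>)"
    proof (intro expectation_mono_finite finq)
      fix xs
      \<comment> \<open>The exponent is split as \<open>(s / \<rho>) * \<rho>\<close>: the inner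
        power is distributed over the sum, the outer one is left for Jensen's inequality.\<close>
      have "rpow (S xs) s = (S xs powr (s / \<rho>)) powr \<rho>"
        using sr by (simp add: rpow_def powr_powr)
      also have "\<dots> \<le> sum_list (map (\<lambda>x. \<psi> x powr (s / \<rho>)) xs) powr \<rho>"
        unfolding S_def using sr nn by (intro powr_mono2 powr_sum_list_le) auto
      finally show "rpow (S xs) s \<le> sum_list (map (\<lambda>x. \<psi> x powr (s / \<rho>)) xs) powr \<rho>" .
    qed
    also have "\<dots> \<le>
        measure_pmf.expectation q (\<lambda>xs. sum_list (map (\<lambda>x. \<psi> x powr (s / \<rho>)) xs)) powr \<rho>"
      using sr s by (intro expectation_powr_le finq sum_list_nonneg) auto
    also have "\<dots> = (real (n - 1) * e) powr \<rho>"
      by (simp add: q_def expectation_replicate_sum_list fin e_def)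
    \<comment> \<open>Only \<open>n - 1\<close> rivals remain, so \<open>N\<close> has to dominate
      \<open>n - 1\<close> rather than \<open>n\<close>.\<close>
    also have "\<dots> \<le> (N * e) powr \<rho>"
      using i N sr by (intro powr_mono2 mult_right_mono) (auto simp: e_def of_nat_diff)
    also have "\<dots> = N powr \<rho> * e powr \<rho>"
      using N by (simp add: powr_mult e_def)
    finally show ?thesis using sr by (simp add: e_def rpow_def)
  qed
  have "measure_pmf.expectation (replicate_pmf n p)
      (\<lambda>C. min (a * \<phi> (C ! i)) (b * sum_list (map \<psi> (take i C @ drop (Suc i) C)))) =
    measure_pmf.expectation (map_pmf (\<lambda>xs. (xs ! i, take i xs @ drop (Suc i) xs)) (replicate_pmf n p))
      (\<lambda>z. min (a * \<phi> (fst z)) (b * S (snd z)))"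
    by (simp add: S_def)
  also have "\<dots> = measure_pmf.expectation (pair_pmf p q) (\<lambda>z. min (a * \<phi> (fst z)) (b * S (snd z)))"
    by (simp only: replicate_pmf_split_nth [OF i] q_def)
  also have "\<dots> \<le> measure_pmf.expectation (pair_pmf p q)
      (\<lambda>z. (a powr (1 - s) * rpow (\<phi> (fst z)) (1 - s)) * (b powr s * rpow (S (snd z)) s))"
  proof (intro expectation_mono_finite)
    fix z
    show "min (a * \<phi> (fst z)) (b * S (snd z)) \<le>
        (a powr (1 - s) * rpow (\<phi> (fst z)) (1 - s)) * (b powr s * rpow (S (snd z)) s)"
      using min_le_rpow_mult[of "a * \<phi> (fst z)" "b * S (snd z)" s] ab nn S0 s by (simp add: rp)
  qed (simp add: fin finq)
  also have "\<dots> = (a powr (1 - s) * measure_pmf.expectation p (\<lambda>x. rpow (\<phi> x) (1 - s))) *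
      (b powr s * measure_pmf.expectation q (\<lambda>xs. rpow (S xs) s))"
    by (subst expectation_pair_mult) (simp_all add: fin finq)
  also have "\<dots> \<le> (a powr (1 - s) * measure_pmf.expectation p (\<lambda>x. rpow (\<phi> x) (1 - s))) *
      (b powr s * (N powr \<rho> * rpow (measure_pmf.expectation p (\<lambda>x. rpow (\<psi> x) (s / \<rho>))) \<rho>))"
    by (intro mult_left_mono S_bound) (auto intro!: mult_nonneg_nonneg integral_nonneg_AE)
  finally show ?thesis by (simp add: mult_ac)
qed

section \<open>Words, block likelihoods and their single-letter averages\<close>

lemma finite_words [simp]: "finite (words n :: 'a::finite list set)"
  unfolding words_def using finite_lists_length_eq[of "UNIV :: 'a set" n] by simp

lemma words_nonempty [simp]: "words n \<noteq> {}"
  unfolding words_def using Ex_list_of_length by auto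

text \<open>The distributive law. The factors depend on the position because they will involve
  \<open>y ! i\<close> for a fixed word \<open>y\<close>; this also lets the induction pass to the
  shifted family.\<close>

lemma sum_words_prod:
  fixes h :: "nat \<Rightarrow> 'a::finite \<Rightarrow> real"
  shows "(\<Sum>x\<in>words n. \<Prod>i<n. h i (x ! i)) = (\<Prod>i<n. \<Sum>a\<in>UNIV. h i a)"
proof (induction n arbitrary: h)
  case 0
  have "words 0 = {[] :: 'a list}" by (auto simp: words_def)
  then show ?case by simp
next
  case (Suc n)
  have img: "words (Suc n) = (\<lambda>(a, x). a # x) ` (UNIV \<times> words n :: ('a \<times> 'a list) set)"
    by (auto simp: words_def length_Suc_conv image_iff)
  have "(\<Sum>x\<in>words (Suc n). \<Prod>i<Suc n. h i (x ! i)) =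
      (\<Sum>(a, x)\<in>UNIV \<times> words n. h 0 a * (\<Prod>i<n. h (Suc i) (x ! i)))"
    unfolding img
    by (subst sum.reindex) (auto simp: inj_on_def prod.lessThan_Suc_shift case_prod_unfold simp del: prod.lessThan_Suc)
  also have "\<dots> = (\<Sum>a\<in>UNIV. h 0 a) * (\<Prod>i<n. \<Sum>a\<in>UNIV. h (Suc i) a)"
    by (simp add: Suc[of "\<lambda>i. h (Suc i)", symmetric] sum_product sum.cartesian_product)
  finally show ?case by (simp add: prod.lessThan_Suc_shift del: prod.lessThan_Suc)
qed

lemma card_words: "card (words n :: 'a::finite list set) = CARD('a) ^ n"
  unfolding words_def using card_lists_length_eq[of "UNIV :: 'a set" n] by simp

lemma block_prob_nonneg [simp]: "0 \<le> block_prob P \<theta> x y"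
  by (simp add: block_prob_def prod_nonneg)

lemma block_prob_le_1: "block_prob P \<theta> x y \<le> 1"
  by (simp add: block_prob_def prod_le_1 pmf_le_1)

definition avg_pow :: "('t \<Rightarrow> 'x::finite \<Rightarrow> 'y pmf) \<Rightarrow> real \<Rightarrow> 't \<Rightarrow> 'y \<Rightarrow> real" where
  "avg_pow P lam \<theta> y = (\<Sum>x\<in>UNIV. rpow (pmf (P \<theta> x) y) lam) / real CARD('x)"

lemma avg_pow_nonneg [simp]: "0 \<le> avg_pow P lam \<theta> y"
  by (simp add: avg_pow_def sum_nonneg)

text \<open>For \<open>\<theta>' = \<theta>\<close> this is the argument of the logarithm in
  \<open>E0\<close> at the uniform input distribution.\<close>

definition pair_sum ::
  "('t \<Rightarrow> 'x::finite \<Rightarrow> 'y::finite pmf) \<Rightarrow> 't \<Rightarrow> 't \<Rightarrow> real \<Rightarrow> real \<Rightarrow> real" where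
  "pair_sum P \<theta> \<theta>' s \<rho> =
     (\<Sum>y\<in>UNIV. avg_pow P (1 - s) \<theta> y * rpow (avg_pow P (s / \<rho>) \<theta>' y) \<rho>)"

lemma expectation_words_block_prob:
  fixes P :: "'t \<Rightarrow> 'x::finite \<Rightarrow> 'y pmf"
  shows "measure_pmf.expectation (pmf_of_set (words n)) (\<lambda>x. rpow (block_prob P \<theta> x y) lam) =
    (\<Prod>i<n. avg_pow P lam \<theta> (y ! i))"
proof -
  have "measure_pmf.expectation (pmf_of_set (words n)) (\<lambda>x. rpow (block_prob P \<theta> x y) lam) =
      (\<Sum>x\<in>words n. rpow (block_prob P \<theta> x y) lam) / card (words n :: 'x list set)"
    by (subst integral_pmf_of_set) auto
  also have "(\<Sum>x\<in>words n. rpow (block_prob P \<theta> x y) lam) =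
      (\<Sum>x\<in>words n. \<Prod>i<n. rpow (pmf (P \<theta> (x ! i)) (y ! i)) lam)"
    by (intro sum.cong) (auto simp: block_prob_def rpow_prod words_def)
  also have "\<dots> = (\<Prod>i<n. \<Sum>a\<in>UNIV. rpow (pmf (P \<theta> a) (y ! i)) lam)"
    by (rule sum_words_prod)
  finally show ?thesis
    by (simp add: card_words avg_pow_def prod_dividef)
qed

lemma sum_words_pair_sum:
  "(\<Sum>y\<in>words n. (\<Prod>i<n. avg_pow P (1 - s) \<theta> (y ! i)) *
     rpow (\<Prod>i<n. avg_pow P (s / \<rho>) \<theta>' (y ! i)) \<rho>) = pair_sum P \<theta> \<theta>' s \<rho> ^ n"
  using sum_words_prod[of "\<lambda>i y. avg_pow P (1 - s) \<theta> y * rpow (avg_pow P (s / \<rho>) \<theta>' y) \<rho>" n]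
  by (simp add: pair_sum_def rpow_prod prod.distrib)

section \<open>Forney's exponent\<close>

text \<open>Probabilities do not exceed their powers with exponent in [0, 1], so the sum under the
  logarithm is at least the sum of the squared output probabilities \<open>q y\<close>, and this is
  at least the reciprocal of the alphabet size.\<close>

lemma E0_le:
  fixes P :: "'t \<Rightarrow> 'x::finite \<Rightarrow> 'y::finite pmf"
  assumes s: "0 \<le> s" "s \<le> \<rho>" "\<rho> \<le> 1"
  shows "E0 P s \<rho> Q \<theta> \<le> ln (real CARD('y))"
proof -
  define q where "q y = (\<Sum>x\<in>UNIV. pmf Q x * pmf (P \<theta> x) y)" for y
  have q0: "0 \<le> q y" for y by (simp add: q_def sum_nonneg)
  have sumQ: "(\<Sum>x\<in>UNIV. pmf Q x) = 1" by (simp add: sum_pmf_eq_1)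
  have "(\<Sum>y\<in>UNIV. q y) = (\<Sum>x\<in>UNIV. \<Sum>y\<in>UNIV. pmf Q x * pmf (P \<theta> x) y)"
    unfolding q_def by (rule sum.swap)
  also have "\<dots> = 1"
    by (simp add: sum_pmf_eq_1 sumQ flip: sum_distrib_left)
  finally have sumq: "(\<Sum>y\<in>UNIV. q y) = 1" .
  have q1: "q y \<le> 1" for y
    using member_le_sum[of y UNIV q] q0 by (simp add: sumq)
  have lower: "q y \<le> (\<Sum>x\<in>UNIV. pmf Q x * rpow (pmf (P \<theta> x) y) t)" if "0 \<le> t" "t \<le> 1" for t y
    unfolding q_def using that by (intro sum_mono mult_left_mono le_rpow) (auto simp: pmf_le_1)
  \<comment> \<open>The Cauchy-Schwarz inequality against the constant 1.\<close>
  have "(\<Sum>y\<in>(UNIV :: 'y set). q y)\<^sup>2 \<le> (\<Sum>y\<in>(UNIV :: 'y set). (q y)\<^sup>2) * real CARD('y)"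
    using sum_squared_le_sum_of_squares[of q UNIV] by simp
  then have "1 / real CARD('y) \<le> (\<Sum>y\<in>UNIV. (q y)\<^sup>2)"
    by (simp add: sumq field_simps)
  also have "\<dots> \<le> (\<Sum>y\<in>UNIV. (\<Sum>x\<in>UNIV. pmf Q x * rpow (pmf (P \<theta> x) y) (1 - s))
             * rpow (\<Sum>x'\<in>UNIV. pmf Q x' * rpow (pmf (P \<theta> x') y) (s / \<rho>)) \<rho>)" (is "_ \<le> ?S")
  proof (intro sum_mono)
    fix y
    \<comment> \<open>This includes \<open>\<rho> = 0\<close>, where the quotient is 0.\<close>
    have "s / \<rho> \<le> 1" "0 \<le> s / \<rho>" using s by (auto simp: divide_le_eq)
    then have "q y \<le> rpow (q y) \<rho>"
        "rpow (q y) \<rho> \<le> rpow (\<Sum>x'\<in>UNIV. pmf Q x' * rpow (pmf (P \<theta> x') y) (s / \<rho>)) \<rho>"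
      using s q0 q1 lower by (auto intro!: le_rpow rpow_mono)
    then show "(q y)\<^sup>2 \<le> (\<Sum>x\<in>UNIV. pmf Q x * rpow (pmf (P \<theta> x) y) (1 - s))
             * rpow (\<Sum>x'\<in>UNIV. pmf Q x' * rpow (pmf (P \<theta> x') y) (s / \<rho>)) \<rho>"
      unfolding power2_eq_square using s q0 by (intro mult_mono lower sum_nonneg) auto
  qed
  finally have "1 / real CARD('y) \<le> ?S" .
  then have "ln (1 / real CARD('y)) \<le> ln ?S"
    by (intro ln_mono) auto
  then show ?thesis by (simp add: E0_def ln_div)
qed

text \<open>The choice \<open>s = \<rho> = 0\<close> gives the value 0 for every input distribution,
  and the bound on \<open>E0\<close> is uniform. The upper bound also shows that the real supremum
  in \<open>E1\<close> ranges over a bounded set.\<close>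

lemma E1_bounds:
  fixes P :: "'t \<Rightarrow> 'x::finite \<Rightarrow> 'y::finite pmf"
  assumes "0 \<le> R" "0 \<le> T"
  shows "0 \<le> E1 P R T \<theta>" "E1 P R T \<theta> \<le> ln (real CARD('y))"
proof -
  let ?g = "\<lambda>((s, \<rho>), Q). E0 P s \<rho> Q \<theta> - \<rho> * R - s * T"
  have ub: "?g z \<le> ln (real CARD('y))" if "z \<in> s_rho_range \<times> UNIV" for z
  proof -
    obtain s \<rho> Q where z: "z = ((s, \<rho>), Q)" by (cases z) auto
    with that have s: "0 \<le> s" "s \<le> \<rho>" "\<rho> \<le> 1" by (auto simp: s_rho_range_def)
    then have "0 \<le> \<rho> * R" "0 \<le> s * T" using assms by auto
    with E0_le[OF s, of P Q \<theta>] show ?thesis by (simp add: z)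
  qed
  have mem: "((0, 0), return_pmf undefined) \<in> s_rho_range \<times> (UNIV :: 'x pmf set)"
    by (simp add: s_rho_range_def)
  show "E1 P R T \<theta> \<le> ln (real CARD('y))"
    unfolding E1_def using mem ub by (intro cSUP_least) auto
  have "E0 P 0 0 Q \<theta> = 0" for Q
  proof -
    have "(\<Sum>y\<in>UNIV. \<Sum>x\<in>UNIV. pmf Q x * pmf (P \<theta> x) y) =
        (\<Sum>x\<in>UNIV. pmf Q x * (\<Sum>y\<in>UNIV. pmf (P \<theta> x) y))"
      by (subst sum.swap) (simp add: sum_distrib_left)
    then show ?thesis by (simp add: E0_def sum_pmf_eq_1)
  qed
  then show "0 \<le> E1 P R T \<theta>"
    unfolding E1_def using mem ub by (intro cSUP_upper2[OF bdd_aboveI2 mem]) auto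
qed

section \<open>The constant $\xi^*$\<close>

text \<open>Supplies both extremal distributions: the conditional one in \<open>F_fun\<close> and
  the output one in \<open>E_pair\<close>.\<close>

lemma exists_tilted_pmf:
  fixes w :: "'a::finite \<Rightarrow> real"
  assumes "\<And>a. 0 \<le> w a" "0 < sum w UNIV"
  obtains p :: "'a pmf" where "\<And>a. pmf p a = w a / sum w UNIV"
proof -
  define p where "p = embed_pmf (\<lambda>a. w a / sum w UNIV)"
  have "pmf p a = w a / sum w UNIV" for a
    unfolding p_def
  proof (rule pmf_embed_pmf)
    show "(\<integral>\<^sup>+a. ennreal (w a / sum w UNIV) \<partial>count_space UNIV) = 1"
      using assms by (simp add: nn_integral_count_space_finite sum_ennreal flip: sum_divide_distrib)
  qed (use assms in \<open>auto intro: divide_nonneg_pos\<close>)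
  then show ?thesis by (rule that)
qed

text \<open>
  The maximising $P_{x|y}$ is the tilted distribution proportional to $P_\theta(y|x)^\lambda$.
\<close>

lemma F_fun_le:
  fixes P :: "'t \<Rightarrow> 'x::finite \<Rightarrow> 'y::finite pmf"
  assumes lam: "0 \<le> lam" and pos: "\<And>y. 0 < pmf Py y \<Longrightarrow> 0 < avg_pow P lam \<theta> y"
  shows "F_fun P Py lam \<theta> \<le> ereal (- (\<Sum>y\<in>UNIV. pmf Py y * ln (avg_pow P lam \<theta> y)))"
proof -
  define Z where "Z y = real CARD('x) * avg_pow P lam \<theta> y" for y
  have Zsum: "Z y = (\<Sum>x\<in>UNIV. rpow (pmf (P \<theta> x) y) lam)" for y
    by (simp add: Z_def avg_pow_def)
  \<comment> \<open>The tilted distribution is demanded only where \<open>Py\<close> is positive;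
    elsewhere its normaliser \<open>Z y\<close> may vanish.\<close>
  have "\<exists>w. pmf Py y > 0 \<longrightarrow> (\<forall>x. pmf w x = rpow (pmf (P \<theta> x) y) lam / Z y)" for y
  proof (cases "pmf Py y > 0")
    case True
    then have "0 < Z y" using pos by (simp add: Z_def)
    then show ?thesis
      using exists_tilted_pmf[of "\<lambda>x. rpow (pmf (P \<theta> x) y) lam"] by (metis Zsum rpow_nonneg)
  qed auto
  then obtain W where W: "\<And>y x. 0 < pmf Py y \<Longrightarrow> pmf (W y) x = rpow (pmf (P \<theta> x) y) lam / Z y"
    by metis
  define L where "L = (\<Sum>y\<in>UNIV. \<Sum>x\<in>UNIV. pmf Py y * pmf (W y) x * (lam * ln (pmf (P \<theta> x) y)))"
  \<comment> \<open>No infinite value survives: for \<open>lam \<noteq> 0\<close> the tilted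
    distribution gives no mass to inputs of zero likelihood, and for \<open>lam = 0\<close> the
    whole term is 0.\<close>
  have L: "ereal lam * expected_log P \<theta> Py W = ereal L"
  proof (cases "lam = 0")
    case True
    then show ?thesis by (simp add: L_def flip: zero_ereal_def)
  next
    case False
    have "ereal (pmf Py y * pmf (W y) x) * eln (pmf (P \<theta> x) y) =
        ereal (pmf Py y * pmf (W y) x * ln (pmf (P \<theta> x) y))" for x y
    proof (cases "pmf Py y > 0 \<and> pmf (P \<theta> x) y = 0")
      case True
      then have "pmf (W y) x = 0" using False W by (simp add: rpow_def)
      then show ?thesis by (simp flip: zero_ereal_def)
    next
      case c: False
      then have "pmf Py y = 0 \<or> pmf (P \<theta> x) y > 0"
        using pmf_nonneg[of Py y] pmf_nonneg[of "P \<theta> x" y] by (metis less_eq_real_def)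
      then show ?thesis by (auto simp: eln_def)
    qed
    then have "expected_log P \<theta> Py W =
        ereal (\<Sum>y\<in>UNIV. \<Sum>x\<in>UNIV. pmf Py y * pmf (W y) x * ln (pmf (P \<theta> x) y))"
      by (simp add: expected_log_def)
    then show ?thesis by (simp add: L_def sum_distrib_left mult_ac)
  qed
  have "cond_entropy Py W + L =
      (\<Sum>y\<in>UNIV. pmf Py y * (\<Sum>x\<in>UNIV. pmf (W y) x * (lam * ln (pmf (P \<theta> x) y) - ln (pmf (W y) x))))"
    by (simp add: cond_entropy_def L_def entropy_pmf_def sum_distrib_left sum_negf
        right_diff_distrib sum_subtractf mult_ac flip: sum.distrib)
  also have "\<dots> = (\<Sum>y\<in>UNIV. pmf Py y * ln (Z y))"
  proof (intro sum.cong refl)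
    fix y
    show "pmf Py y * (\<Sum>x\<in>UNIV. pmf (W y) x * (lam * ln (pmf (P \<theta> x) y) - ln (pmf (W y) x))) =
        pmf Py y * ln (Z y)"
    proof (cases "pmf Py y = 0")
      case False
      then have p: "0 < pmf Py y" using pmf_nonneg[of Py y] by linarith
      then have Zp: "0 < Z y" using pos by (simp add: Z_def)
      \<comment> \<open>On the support of the tilted distribution the difference of logarithms is
        the constant \<open>ln (Z y)\<close>.\<close>
      have "pmf (W y) x * (lam * ln (pmf (P \<theta> x) y) - ln (pmf (W y) x)) = pmf (W y) x * ln (Z y)" for x
      proof (cases "pmf (W y) x = 0")
        case nz: False
        then have r: "0 < rpow (pmf (P \<theta> x) y) lam"
          using W[OF p, of x] rpow_nonneg[of "pmf (P \<theta> x) y" lam] by (auto simp: less_eq_real_def)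
        have "ln (rpow (pmf (P \<theta> x) y) lam) = lam * ln (pmf (P \<theta> x) y)"
          using r by (auto simp: rpow_def ln_powr split: if_splits)
        then show ?thesis using r Zp by (simp add: W[OF p] ln_div)
      qed simp
      then show ?thesis by (simp only: sum_distrib_right [symmetric]) (simp add: sum_pmf_eq_1)
    qed simp
  qed
  also have "\<dots> = (\<Sum>y\<in>UNIV. pmf Py y * ln (real CARD('x)) + pmf Py y * ln (avg_pow P lam \<theta> y))"
  proof (intro sum.cong refl)
    fix y
    show "pmf Py y * ln (Z y) =
        pmf Py y * ln (real CARD('x)) + pmf Py y * ln (avg_pow P lam \<theta> y)"
      using pos[of y] pmf_nonneg[of Py y]
      by (cases "pmf Py y = 0") (auto simp: Z_def ln_mult distrib_left)
  qed
  also have "\<dots> = ln (real CARD('x)) + (\<Sum>y\<in>UNIV. pmf Py y * ln (avg_pow P lam \<theta> y))"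
    by (simp add: sum.distrib sum_pmf_eq_1 flip: sum_distrib_right)
  finally have val: "cond_entropy Py W + L = ln (real CARD('x)) + (\<Sum>y\<in>UNIV. pmf Py y * ln (avg_pow P lam \<theta> y))" .
  \<comment> \<open>A single candidate bounds the supremum from below and hence \<open>F_fun\<close>
    from above.\<close>
  have "F_fun P Py lam \<theta> \<le> ereal (ln (real CARD('x))) - (ereal (cond_entropy Py W) + ereal lam * expected_log P \<theta> Py W)"
    unfolding F_fun_def by (intro ereal_minus_mono SUP_upper) auto
  also have "\<dots> = ereal (- (\<Sum>y\<in>UNIV. pmf Py y * ln (avg_pow P lam \<theta> y)))"
    unfolding L using val by simp
  finally show ?thesis .
qed

text \<open>The candidate \<open>Py\<close> is the normalised summand of \<open>pair_sum\<close>.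
  Its log-probabilities are those of the two factors minus \<open>ln Z\<close>, so the entropy
  cancels the two bounds on \<open>F_fun\<close> and leaves \<open>- ln Z\<close>.\<close>

lemma E_pair_le:
  fixes P :: "'t \<Rightarrow> 'x::finite \<Rightarrow> 'y::finite pmf"
  assumes s: "0 \<le> s" "s \<le> \<rho>" "\<rho> \<le> 1" and pos: "0 < pair_sum P \<theta> \<theta>' s \<rho>"
  shows "E_pair P \<theta> \<theta>' s \<rho> \<le> ereal (- ln (pair_sum P \<theta> \<theta>' s \<rho>))"
proof -
  define A where "A = avg_pow P (1 - s) \<theta>"
  define B where "B = avg_pow P (s / \<rho>) \<theta>'"
  define Z where "Z = pair_sum P \<theta> \<theta>' s \<rho>"
  have Z: "Z = (\<Sum>y\<in>UNIV. A y * rpow (B y) \<rho>)" by (simp add: Z_def pair_sum_def A_def B_def)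
  have nn: "0 \<le> A y" "0 \<le> B y" for y by (simp_all add: A_def B_def)
  obtain Py where Py: "\<And>y. pmf Py y = A y * rpow (B y) \<rho> / Z"
    using exists_tilted_pmf[of "\<lambda>y. A y * rpow (B y) \<rho>"] pos nn by (auto simp: Z Z_def[symmetric])
  have Zp: "0 < Z" using pos by (simp add: Z_def)
  \<comment> \<open>Positivity on the support of \<open>Py\<close> is the hypothesis under which
    \<open>F_fun_le\<close> applies to both factors.\<close>
  have AB: "0 < A y" "0 < B y" if "0 < pmf Py y" for y
  proof -
    have "A y \<noteq> 0" "rpow (B y) \<rho> \<noteq> 0" using that by (auto simp: Py)
    then show "0 < A y" using nn[of y] by linarith
    have "B y \<noteq> 0"
    proof (cases "\<rho> = 0")
      case True
      \<comment> \<open>Here \<open>s / \<rho>\<close> is 0 by division by zero, and powers with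
        exponent 0 are 1.\<close>
      then have "B y = 1" by (simp add: B_def avg_pow_def)
      then show ?thesis by simp
    next
      case False
      then show ?thesis using \<open>rpow (B y) \<rho> \<noteq> 0\<close> by (auto simp: rpow_def)
    qed
    then show "0 < B y" using nn[of y] by linarith
  qed
  have lnPy: "pmf Py y * ln (pmf Py y) = pmf Py y * ln (A y) + \<rho> * (pmf Py y * ln (B y)) - pmf Py y * ln Z" for y
  proof (cases "pmf Py y = 0")
    case False
    then have p: "0 < pmf Py y" using pmf_nonneg[of Py y] by linarith
    have "ln (rpow (B y) \<rho>) = \<rho> * ln (B y)" using AB[OF p] by (simp add: rpow_def ln_powr)
    moreover have "0 < rpow (B y) \<rho>" using AB[OF p] by (simp add: rpow_def)
    ultimately have "ln (pmf Py y) = ln (A y) + \<rho> * ln (B y) - ln Z"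
      unfolding Py using AB[OF p] Zp by (simp add: ln_div ln_mult)
    then show ?thesis by (simp only:) (simp add: algebra_simps)
  qed simp
  define a where "a = - (\<Sum>y\<in>UNIV. pmf Py y * ln (A y))"
  define b where "b = - (\<Sum>y\<in>UNIV. pmf Py y * ln (B y))"
  have ent: "entropy_pmf Py = a + \<rho> * b + ln Z"
    unfolding entropy_pmf_def lnPy a_def b_def sum.distrib sum_subtractf
    by (simp add: sum_pmf_eq_1 flip: sum_distrib_left sum_distrib_right)
  have "E_pair P \<theta> \<theta>' s \<rho> \<le>
      F_fun P Py (1 - s) \<theta> + ereal \<rho> * F_fun P Py (s / \<rho>) \<theta>' - ereal (entropy_pmf Py)"
    unfolding E_pair_def by (intro INF_lower) auto
  also have "\<dots> \<le> ereal a + ereal \<rho> * ereal b - ereal (entropy_pmf Py)"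
    unfolding a_def b_def A_def B_def
    by (intro ereal_minus_mono add_mono ereal_mult_left_mono F_fun_le order_refl)
      (use s AB in \<open>auto simp: A_def B_def\<close>)
  also have "\<dots> = ereal (- ln Z)" by (simp add: ent)
  finally show ?thesis by (simp add: Z_def)
qed

lemma pair_sum_0: "pair_sum P \<theta> \<theta>' 0 0 = 1"
proof -
  have "(\<Sum>y\<in>UNIV. \<Sum>x\<in>UNIV. pmf (P \<theta> x) y) = (\<Sum>x\<in>UNIV. \<Sum>y\<in>UNIV. pmf (P \<theta> x) y)"
    by (rule sum.swap)
  then show ?thesis
    by (simp add: pair_sum_def avg_pow_def sum_pmf_eq_1 flip: sum_divide_distrib)
qed

text \<open>The infimum defining \<open>xi_star\<close> bounds the supremum of the ratios for this
  pair from below, and \<open>\<epsilon>\<close> makes up for a supremum that need not be attained.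
  \<open>E_pair_le\<close> turns the chosen ratio into a bound on \<open>pair_sum\<close>.\<close>

lemma xi_star_pair_sum:
  fixes P :: "'t \<Rightarrow> 'x::finite \<Rightarrow> 'y::finite pmf"
  assumes RT: "0 \<le> R" "0 \<le> T" and th: "\<theta> \<in> \<Theta>" "\<theta>' \<in> \<Theta>" and eps: "0 < \<epsilon>"
  shows "\<exists>s \<rho>. 0 \<le> s \<and> s \<le> \<rho> \<and> \<rho> \<le> 1 \<and> pair_sum P \<theta> \<theta>' s \<rho> \<le>
     exp (- ((xi_star P \<Theta> R T - \<epsilon>) * ((1 - s) * E1 P R T \<theta> + s * E1 P R T \<theta>') + \<rho> * R + s * T))"
proof -
  define I where "I = (INF (\<theta>, \<theta>')\<in>\<Theta> \<times> \<Theta>. SUP (s, \<rho>)\<in>s_rho_range.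
        exponent_ratio (E_pair P \<theta> \<theta>' s \<rho> - ereal (\<rho> * R) - ereal (s * T))
          ((1 - s) * E1 P R T \<theta> + s * E1 P R T \<theta>'))"
  have xi: "xi_star P \<Theta> R T = real_of_ereal I" by (simp add: xi_star_def I_def)
  show ?thesis
  proof (cases "I = -\<infinity>")
    case True
    \<comment> \<open>The real part of an infinite value is 0, so \<open>s = \<rho> = 0\<close>
      already suffices.\<close>
    then have "xi_star P \<Theta> R T - \<epsilon> \<le> 0" using eps by (simp add: xi)
    then show ?thesis
      using E1_bounds(1)[OF RT, of P \<theta>]
      by (intro exI[of _ 0]) (simp add: pair_sum_0 mult_nonpos_nonneg)
  next
    case False
    define c where "c = xi_star P \<Theta> R T - \<epsilon>"
    \<comment> \<open>For \<open>I = \<infinity>\<close> this holds as well, \<open>xi_star\<close>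
      then being 0.\<close>
    have "ereal c < I" using False eps by (cases I) (auto simp: c_def xi)
    also have "I \<le> (SUP (s, \<rho>)\<in>s_rho_range.
        exponent_ratio (E_pair P \<theta> \<theta>' s \<rho> - ereal (\<rho> * R) - ereal (s * T))
          ((1 - s) * E1 P R T \<theta> + s * E1 P R T \<theta>'))"
      unfolding I_def using th by (intro INF_lower2[of "(\<theta>, \<theta>')"]) auto
    finally obtain s \<rho> where s: "0 \<le> s" "s \<le> \<rho>" "\<rho> \<le> 1" and
      lt: "ereal c < exponent_ratio (E_pair P \<theta> \<theta>' s \<rho> - ereal (\<rho> * R) - ereal (s * T))
          ((1 - s) * E1 P R T \<theta> + s * E1 P R T \<theta>')"
      unfolding less_SUP_iff by (auto simp: s_rho_range_def)
    define D where "D = (1 - s) * E1 P R T \<theta> + s * E1 P R T \<theta>'"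
    define a where "a = E_pair P \<theta> \<theta>' s \<rho> - ereal (\<rho> * R) - ereal (s * T)"
    have D: "0 \<le> D" unfolding D_def using s E1_bounds(1)[OF RT] by (intro add_nonneg_nonneg mult_nonneg_nonneg) auto
    define Z where "Z = pair_sum P \<theta> \<theta>' s \<rho>"
    have "Z \<le> exp (- (c * D + \<rho> * R + s * T))"
    proof (cases "0 < Z")
      case True
      have "a \<le> ereal (- ln Z) - ereal (\<rho> * R) - ereal (s * T)"
        unfolding a_def Z_def using True s by (intro ereal_minus_mono E_pair_le) (auto simp: Z_def)
      then have a: "a \<le> ereal (- ln Z - \<rho> * R - s * T)" by simp
      have lt: "ereal c < exponent_ratio a D" using lt by (simp add: a_def D_def)
      have "c * D \<le> - ln Z - \<rho> * R - s * T"
      proof (cases "D = 0")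
        case D0: True
        \<comment> \<open>With a vanishing denominator, a negative numerator would make the ratio
          minus infinity, which cannot exceed \<open>c\<close>.\<close>
        have "0 \<le> a"
        proof (rule ccontr)
          assume "\<not> 0 \<le> a"
          then have "exponent_ratio a D = -\<infinity>"
            using D0 by (cases a) (auto simp: exponent_ratio_def divide_ereal_def)
          then show False using lt by simp
        qed
        then have "0 \<le> ereal (- ln Z - \<rho> * R - s * T)" using a by (rule order_trans)
        then show ?thesis using D0 by simp
      next
        case False
        then have Dp: "0 < D" using D by simp
        have "ereal c < a / ereal D" using lt False by (simp add: exponent_ratio_def)
        also have "\<dots> \<le> ereal (- ln Z - \<rho> * R - s * T) / ereal D"
          using a Dp by (intro ereal_divide_right_mono) auto
        finally show ?thesis using Dp by (simp add: field_simps)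
      qed
      then have "ln Z \<le> - (c * D + \<rho> * R + s * T)" by simp
      then show ?thesis using True by (metis exp_le_cancel_iff exp_ln)
    next
      case False
      then show ?thesis by (meson exp_ge_zero linorder_not_less order_trans)
    qed
    then show ?thesis using s unfolding c_def D_def Z_def by (intro exI[of _ s] exI[of _ \<rho>]) simp
  qed
qed

section \<open>The score of the universal decoder\<close>

text \<open>The reciprocal of the benchmark in \<open>K\<close>, and the factor of the likelihood in
  \<open>score\<close>.\<close>

definition weight ::
  "('t \<Rightarrow> 'x::finite \<Rightarrow> 'y::finite pmf) \<Rightarrow> real \<Rightarrow> real \<Rightarrow> real \<Rightarrow> nat \<Rightarrow> 't \<Rightarrow> real" where
  "weight P R T \<xi> n \<theta> = exp (real n * (\<xi> * E1 P R T \<theta> + T))"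

lemma weight_pos [simp]: "0 < weight P R T \<xi> n \<theta>" "0 \<le> weight P R T \<xi> n \<theta>"
  by (simp_all add: weight_def)

lemma score_eq: "score P \<Theta> R T \<xi> n x y = (SUP \<theta>\<in>\<Theta>. weight P R T \<xi> n \<theta> * block_prob P \<theta> x y)"
  by (simp add: score_def weight_def)

lemma weight_bounded:
  fixes P :: "'t \<Rightarrow> 'x::finite \<Rightarrow> 'y::finite pmf"
  assumes RT: "0 \<le> R" "0 \<le> T"
  obtains B where "0 < B" "\<And>\<theta>. weight P R T \<xi> n \<theta> \<le> B"
proof (rule that)
  fix \<theta>
  \<comment> \<open>The absolute value is there because \<open>\<xi>\<close> may be
    negative.\<close>
  have "\<xi> * E1 P R T \<theta> \<le> \<bar>\<xi>\<bar> * ln (real CARD('y))"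
    using E1_bounds[OF RT, of P \<theta>] by (intro mult_mono) auto
  then show "weight P R T \<xi> n \<theta> \<le> exp (real n * (\<bar>\<xi>\<bar> * ln (real CARD('y)) + T))"
    unfolding weight_def by (simp add: mult_left_mono)
qed simp

lemma weight_block_prob_bdd:
  assumes RT: "0 \<le> R" "0 \<le> T"
  shows "bdd_above ((\<lambda>\<theta>. weight P R T \<xi> n \<theta> * block_prob P \<theta> x y) ` \<Theta>)"
proof -
  obtain B where B: "0 < B" "\<And>\<theta>. weight P R T \<xi> n \<theta> \<le> B"
    using weight_bounded[OF RT] by blast
  have "weight P R T \<xi> n \<theta> * block_prob P \<theta> x y \<le> B * 1" for \<theta>
    using B by (intro mult_mono block_prob_le_1) (auto intro: less_imp_le)
  then show ?thesis by (intro bdd_aboveI2)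
qed

lemma weight_le_score:
  assumes "0 \<le> R" "0 \<le> T" "\<theta> \<in> \<Theta>"
  shows "weight P R T \<xi> n \<theta> * block_prob P \<theta> x y \<le> score P \<Theta> R T \<xi> n x y"
  unfolding score_eq by (rule cSUP_upper[OF assms(3) weight_block_prob_bdd[OF assms(1,2)]])

lemma score_nonneg:
  assumes "0 \<le> R" "0 \<le> T" "\<Theta> \<noteq> {}"
  shows "0 \<le> score P \<Theta> R T \<xi> n x y"
proof -
  obtain \<theta> where "\<theta> \<in> \<Theta>" using assms by blast
  have "0 \<le> weight P R T \<xi> n \<theta> * block_prob P \<theta> x y" by simp
  also have "\<dots> \<le> score P \<Theta> R T \<xi> n x y" by (rule weight_le_score) fact+
  finally show ?thesis .
qed

section \<open>Joint types, kept as counts, and the reduction to polynomially many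
  parameters\<close>

definition joint_count :: "'x list \<Rightarrow> 'y list \<Rightarrow> 'x \<times> 'y \<Rightarrow> nat" where
  "joint_count x y ab = card {i \<in> {..<length x}. (x ! i, y ! i) = ab}"

lemma joint_count_le: "joint_count x y ab \<le> length x"
  using card_mono[of "{..<length x}" "{i \<in> {..<length x}. (x ! i, y ! i) = ab}"]
  by (auto simp: joint_count_def)

lemma block_prob_joint_count:
  fixes P :: "'t \<Rightarrow> 'x::finite \<Rightarrow> 'y::finite pmf"
  shows "block_prob P \<theta> x y = (\<Prod>(a, b)\<in>UNIV. pmf (P \<theta> a) b ^ joint_count x y (a, b))"
proof -
  have "block_prob P \<theta> x y =
      (\<Prod>ab\<in>UNIV. \<Prod>i\<in>{i \<in> {..<length x}. (x ! i, y ! i) = ab}. pmf (P \<theta> (x ! i)) (y ! i))"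
    unfolding block_prob_def by (rule prod.group [symmetric]) auto
  also have "\<dots> = (\<Prod>(a, b)\<in>UNIV. pmf (P \<theta> a) b ^ joint_count x y (a, b))"
    by (intro prod.cong refl) (auto simp: joint_count_def)
  finally show ?thesis .
qed

text \<open>
  The likelihood depends on the two words only through their joint type, so that polynomially many
  parameters come within a factor 2 of the supremum, for all pairs of words simultaneously.
\<close>

lemma score_le_sum:
  fixes P :: "'t \<Rightarrow> 'x::finite \<Rightarrow> 'y::finite pmf"
  assumes RT: "0 \<le> R" "0 \<le> T" and ne: "\<Theta> \<noteq> {}"
  obtains \<Theta>' where "finite \<Theta>'" "\<Theta>' \<subseteq> \<Theta>" "card \<Theta>' \<le> (n + 1) ^ CARD('x \<times> 'y)"
    "\<And>x y. length x = n \<Longrightarrow>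
      score P \<Theta> R T \<xi> n x y \<le> 2 * (\<Sum>\<theta>\<in>\<Theta>'. weight P R T \<xi> n \<theta> * block_prob P \<theta> x y)"
proof -
  define G where "G k \<theta> = weight P R T \<xi> n \<theta> * (\<Prod>(a, b)\<in>UNIV. pmf (P \<theta> a) b ^ k (a, b))"
    for k :: "'x \<times> 'y \<Rightarrow> nat" and \<theta>
  have G: "weight P R T \<xi> n \<theta> * block_prob P \<theta> x y = G (joint_count x y) \<theta>" for x y \<theta>
    by (simp add: G_def block_prob_joint_count)
  \<comment> \<open>One parameter per joint type. The factor 2 replaces attainment of the supremum,
    which can fail for infinite \<open>\<Theta>\<close>.\<close>
  have "\<exists>\<theta>\<in>\<Theta>. \<forall>x y. joint_count x y = k \<longrightarrow> score P \<Theta> R T \<xi> n x y \<le> 2 * G k \<theta>" for k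
  proof -
    define S where "S = (SUP \<theta>\<in>\<Theta>. G k \<theta>)"
    have S: "score P \<Theta> R T \<xi> n x y = S" if "joint_count x y = k" for x y
      by (simp add: score_eq G that S_def)
    have "\<exists>\<theta>\<in>\<Theta>. S \<le> 2 * G k \<theta>"
    proof (cases "S > 0")
      case True
      then have "S / 2 < (SUP \<theta>\<in>\<Theta>. G k \<theta>)" by (simp add: S_def)
      then obtain \<theta> where "\<theta> \<in> \<Theta>" "S / 2 < G k \<theta>"
        using less_cSupD[of "G k ` \<Theta>" "S / 2"] ne by auto
      then show ?thesis by (intro bexI[of _ \<theta>]) auto
    next
      case False
      obtain \<theta> where "\<theta> \<in> \<Theta>" using ne by blast
      moreover have "0 \<le> G k \<theta>" by (auto simp: G_def intro!: mult_nonneg_nonneg prod_nonneg)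
      ultimately show ?thesis using False by (intro bexI[of _ \<theta>]) auto
    qed
    then show ?thesis using S by blast
  qed
  then obtain t where t: "\<And>k. t k \<in> \<Theta>"
    "\<And>k x y. joint_count x y = k \<Longrightarrow> score P \<Theta> R T \<xi> n x y \<le> 2 * G k (t k)"
    by metis
  \<comment> \<open>Each letter pair occurs between 0 and \<open>n\<close> times.\<close>
  define Ks where "Ks = (UNIV :: ('x \<times> 'y) set) \<rightarrow>\<^sub>E {..n}"
  have fin: "finite Ks" unfolding Ks_def by (intro finite_PiE) auto
  have card: "card Ks = (n + 1) ^ CARD('x \<times> 'y)"
    unfolding Ks_def by (simp add: card_PiE)
  show ?thesis
  proof (rule that[of "t ` Ks"])
    show "finite (t ` Ks)" using fin by simp
    show "t ` Ks \<subseteq> \<Theta>" using t by auto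
    show "card (t ` Ks) \<le> (n + 1) ^ CARD('x \<times> 'y)" using card_image_le[OF fin, of t] card by simp
    fix x :: "'x list" and y :: "'y list" assume len: "length x = n"
    have "joint_count x y \<in> Ks" unfolding Ks_def using joint_count_le[of x y] len by auto
    then have "weight P R T \<xi> n (t (joint_count x y)) * block_prob P (t (joint_count x y)) x y
        \<le> (\<Sum>\<theta>\<in>t ` Ks. weight P R T \<xi> n \<theta> * block_prob P \<theta> x y)"
      using fin by (intro member_le_sum) auto
    then show "score P \<Theta> R T \<xi> n x y \<le> 2 * (\<Sum>\<theta>\<in>t ` Ks. weight P R T \<xi> n \<theta> * block_prob P \<theta> x y)"
      using t(2)[OF refl, of x y] by (simp add: G)
  qed
qed

section \<open>Minimal risk and the decoders that attain it\<close>

definition rival_score ::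
  "('t \<Rightarrow> 'x::finite \<Rightarrow> 'y::finite pmf) \<Rightarrow> 't set \<Rightarrow> real \<Rightarrow> real \<Rightarrow> real \<Rightarrow> nat \<Rightarrow>
     'x list list \<Rightarrow> nat \<Rightarrow> 'y list \<Rightarrow> real" where
  "rival_score P \<Theta> R T \<xi> n C m y =
     (\<Sum>m'\<in>{1..length C} - {m}. score P \<Theta> R T \<xi> n (codeword C m') y)"

text \<open>The Lagrangian with weighted likelihoods replaced by scores, each pair of message and
  word taking the cheaper of its two possible costs.\<close>

definition minimal_risk ::
  "('t \<Rightarrow> 'x::finite \<Rightarrow> 'y::finite pmf) \<Rightarrow> 't set \<Rightarrow> real \<Rightarrow> real \<Rightarrow> real \<Rightarrow> nat \<Rightarrow>
     'x list list \<Rightarrow> real" where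
  "minimal_risk P \<Theta> R T \<xi> n C = 1 / real (length C) *
     (\<Sum>m\<in>{1..length C}. \<Sum>y\<in>words n.
        min (exp (- real n * T) * score P \<Theta> R T \<xi> n (codeword C m) y) (rival_score P \<Theta> R T \<xi> n C m y))"

text \<open>A property of regions that leaves ties open, so that it covers
  \<open>universal_decoder\<close> and also a disjoint modification of it.\<close>

definition optimal_regions ::
  "('t \<Rightarrow> 'x::finite \<Rightarrow> 'y::finite pmf) \<Rightarrow> 't set \<Rightarrow> real \<Rightarrow> real \<Rightarrow> real \<Rightarrow> nat \<Rightarrow>
     'x list list \<Rightarrow> (nat \<Rightarrow> 'y list set) \<Rightarrow> bool" where
  "optimal_regions P \<Theta> R T \<xi> n C Reg \<longleftrightarrow>
     (\<forall>m\<in>{1..length C}. \<forall>y\<in>words n.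
        (y \<in> Reg m \<longrightarrow>
           rival_score P \<Theta> R T \<xi> n C m y \<le> exp (- real n * T) * score P \<Theta> R T \<xi> n (codeword C m) y) \<and>
        (y \<notin> Reg m \<longrightarrow>
           exp (- real n * T) * score P \<Theta> R T \<xi> n (codeword C m) y \<le> rival_score P \<Theta> R T \<xi> n C m y))"

lemma rival_score_nonneg:
  assumes "0 \<le> R" "0 \<le> T" "\<Theta> \<noteq> {}"
  shows "0 \<le> rival_score P \<Theta> R T \<xi> n C m y"
  unfolding rival_score_def by (intro sum_nonneg score_nonneg assms)

lemma prob_E1_nonneg: "0 \<le> prob_E1 P \<theta> n C Reg"
  unfolding prob_E1_def by (intro mult_nonneg_nonneg sum_nonneg) auto

lemma prob_E2_nonneg: "0 \<le> prob_E2 P \<theta> n C Reg"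
  unfolding prob_E2_def by (intro mult_nonneg_nonneg sum_nonneg) auto

text \<open>A word inside a region costs its rivals, a word outside costs the discounted own
  likelihood. Scores dominate weighted likelihoods, and optimality says that the cost incurred is
  the smaller one. The bound is the same for all parameters.\<close>

lemma Lagrangian_le_minimal_risk:
  fixes P :: "'t \<Rightarrow> 'x::finite \<Rightarrow> 'y::finite pmf"
  assumes RT: "0 \<le> R" "0 \<le> T" and th: "\<theta> \<in> \<Theta>"
    and opt: "optimal_regions P \<Theta> R T \<xi> n C Reg"
  shows "weight P R T \<xi> n \<theta> * Lagrangian P T \<theta> n C Reg \<le> minimal_risk P \<Theta> R T \<xi> n C"
proof -
  let ?w = "weight P R T \<xi> n \<theta>" and ?M = "length C"
  let ?f = "\<lambda>m y. score P \<Theta> R T \<xi> n (codeword C m) y"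
  let ?r = "rival_score P \<Theta> R T \<xi> n C" and ?e = "exp (- real n * T)"
  have le: "?w * block_prob P \<theta> x y \<le> score P \<Theta> R T \<xi> n x y" for x y
    by (intro weight_le_score RT th)
  have bound: "(\<Sum>y\<in>words n \<inter> Reg m. \<Sum>m'\<in>{1..?M} - {m}. ?w * block_prob P \<theta> (codeword C m') y) +
      (\<Sum>y\<in>words n - Reg m. ?e * (?w * block_prob P \<theta> (codeword C m) y))
      \<le> (\<Sum>y\<in>words n. min (?e * ?f m y) (?r m y))" if m: "m \<in> {1..?M}" for m
  proof -
    have "(\<Sum>y\<in>words n \<inter> Reg m. \<Sum>m'\<in>{1..?M} - {m}. ?w * block_prob P \<theta> (codeword C m') y)
        \<le> (\<Sum>y\<in>words n \<inter> Reg m. min (?e * ?f m y) (?r m y))"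
    proof (intro sum_mono)
      fix y assume y: "y \<in> words n \<inter> Reg m"
      have "(\<Sum>m'\<in>{1..?M} - {m}. ?w * block_prob P \<theta> (codeword C m') y) \<le> ?r m y"
        unfolding rival_score_def by (intro sum_mono le)
      moreover have "?r m y \<le> ?e * ?f m y" using opt m y by (auto simp: optimal_regions_def)
      ultimately show "(\<Sum>m'\<in>{1..?M} - {m}. ?w * block_prob P \<theta> (codeword C m') y)
          \<le> min (?e * ?f m y) (?r m y)" by simp
    qed
    moreover have "(\<Sum>y\<in>words n - Reg m. ?e * (?w * block_prob P \<theta> (codeword C m) y))
        \<le> (\<Sum>y\<in>words n - Reg m. min (?e * ?f m y) (?r m y))"
    proof (intro sum_mono)
      fix y assume y: "y \<in> words n - Reg m"
      have "?e * (?w * block_prob P \<theta> (codeword C m) y) \<le> ?e * ?f m y"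
        by (intro mult_left_mono le) simp
      moreover have "?e * ?f m y \<le> ?r m y" using opt m y by (auto simp: optimal_regions_def)
      ultimately show "?e * (?w * block_prob P \<theta> (codeword C m) y) \<le> min (?e * ?f m y) (?r m y)"
        by simp
    qed
    ultimately show ?thesis
      using sum.Int_Diff[of "words n" "\<lambda>y. min (?e * ?f m y) (?r m y)" "Reg m"] by simp
  qed
  have "?w * Lagrangian P T \<theta> n C Reg = 1 / real ?M * (\<Sum>m\<in>{1..?M}.
      (\<Sum>y\<in>words n \<inter> Reg m. \<Sum>m'\<in>{1..?M} - {m}. ?w * block_prob P \<theta> (codeword C m') y) +
      (\<Sum>y\<in>words n - Reg m. ?e * (?w * block_prob P \<theta> (codeword C m) y)))"
    by (simp add: Lagrangian_def prob_E1_def prob_E2_def sum.distrib sum_distrib_left algebra_simps)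
  also have "\<dots> \<le> minimal_risk P \<Theta> R T \<xi> n C"
    unfolding minimal_risk_def by (intro mult_left_mono sum_mono bound) auto
  finally show ?thesis .
qed

text \<open>Clears the denominator. Positivity of the score records that \<open>0 / 0\<close> is 0,
  while a positive score over 0 is infinite.\<close>

lemma universal_region_iff:
  assumes RT: "0 \<le> R" "0 \<le> T" and ne: "\<Theta> \<noteq> {}"
  shows "y \<in> universal_region P \<Theta> R T \<xi> n C m \<longleftrightarrow> y \<in> words n \<and>
    0 < score P \<Theta> R T \<xi> n (codeword C m) y \<and>
    rival_score P \<Theta> R T \<xi> n C m y \<le> exp (- real n * T) * score P \<Theta> R T \<xi> n (codeword C m) y"
proof -
  define f where "f = score P \<Theta> R T \<xi> n (codeword C m) y"
  define r where "r = rival_score P \<Theta> R T \<xi> n C m y"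
  have f: "0 \<le> f" unfolding f_def by (intro score_nonneg RT ne)
  have r: "0 \<le> r" unfolding r_def by (intro rival_score_nonneg RT ne)
  have "ereal (exp (real n * T)) \<le> ereal f / ereal r \<longleftrightarrow> 0 < f \<and> r \<le> exp (- real n * T) * f"
  proof (cases "r = 0")
    case True
    then show ?thesis using f by (cases "f = 0") (auto simp: divide_ereal_def zero_ereal_def)
  next
    case False
    then have "0 < r" using r by simp
    moreover have "exp (real n * T) * r \<le> f \<longleftrightarrow> r \<le> exp (- real n * T) * f"
      by (simp add: exp_minus field_simps)
    moreover have "0 < f" if "exp (real n * T) * r \<le> f"
      using that \<open>0 < r\<close> by (smt (verit) exp_gt_zero mult_pos_pos)
    ultimately show ?thesis by (auto simp: le_divide_eq)
  qed
  then show ?thesis unfolding universal_region_def f_def r_def rival_score_def by auto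
qed

text \<open>A word is left out either because its score is 0, which no rival score undercuts, or
  because the rival score is too large.\<close>

lemma universal_decoder_optimal:
  assumes RT: "0 \<le> R" "0 \<le> T" and ne: "\<Theta> \<noteq> {}"
  shows "optimal_regions P \<Theta> R T \<xi> n C (universal_decoder P \<Theta> R T \<xi> n C)"
proof -
  have *: "exp (- real n * T) * score P \<Theta> R T \<xi> n (codeword C m) y \<le> rival_score P \<Theta> R T \<xi> n C m y"
    if "y \<in> words n" "y \<notin> universal_region P \<Theta> R T \<xi> n C m" for m y
    using that score_nonneg[OF RT ne, of P \<xi> n "codeword C m" y] rival_score_nonneg[OF RT ne, of P \<xi> n C m y]
    by (cases "score P \<Theta> R T \<xi> n (codeword C m) y = 0") (auto simp: universal_region_iff[OF RT ne])
  show ?thesis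
    unfolding optimal_regions_def universal_decoder_def
    using * by (auto simp: universal_region_iff[OF RT ne])
qed

text \<open>
  For \<open>T = 0\<close> the regions of the universal decoder can overlap in ties, so that they need not form a
  partition; a tie between two codewords forces equality in both defining inequalities, whence giving
  it to the first of them preserves optimality.
\<close>

lemma exists_optimal_decoder:
  fixes P :: "'t \<Rightarrow> 'x::finite \<Rightarrow> 'y::finite pmf"
  assumes RT: "0 \<le> R" "0 \<le> T" and ne: "\<Theta> \<noteq> {}"
  obtains Reg where "Reg \<in> erasure_decoders n (length C)" "optimal_regions P \<Theta> R T \<xi> n C Reg"
proof -
  define U where "U = universal_region P \<Theta> R T \<xi> n C"
  \<comment> \<open>Each word goes to the first region that contains it.\<close>
  define V where "V m = U m - (\<Union>k\<in>{1..<m}. U k)" for m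
  define Reg where "Reg m = (if m = 0 then words n - (\<Union>k\<in>{1..length C}. V k) else V m)" for m
  let ?f = "\<lambda>m y. score P \<Theta> R T \<xi> n (codeword C m) y"
  let ?r = "rival_score P \<Theta> R T \<xi> n C" and ?e = "exp (- real n * T)"
  have U: "y \<in> U m \<longleftrightarrow> y \<in> words n \<and> 0 < ?f m y \<and> ?r m y \<le> ?e * ?f m y" for y m
    unfolding U_def by (rule universal_region_iff[OF RT ne])
  have f0: "0 \<le> ?f m y" for m y by (intro score_nonneg RT ne)
  have r0: "0 \<le> ?r m y" for m y by (intro rival_score_nonneg RT ne)
  have Vsub: "V m \<subseteq> words n" for m by (auto simp: V_def U)
  have part: "Reg \<in> erasure_decoders n (length C)"
  proof -
    have "(\<Union>m\<in>{0..length C}. Reg m) = words n"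
    proof
      show "(\<Union>m\<in>{0..length C}. Reg m) \<subseteq> words n" using Vsub by (auto simp: Reg_def split: if_splits)
      show "words n \<subseteq> (\<Union>m\<in>{0..length C}. Reg m)"
      proof
        fix y :: "'y list" assume y: "y \<in> words n"
        show "y \<in> (\<Union>m\<in>{0..length C}. Reg m)"
        proof (cases "\<exists>k\<in>{1..length C}. y \<in> V k")
          case True
          then obtain k where "k \<in> {1..length C}" "y \<in> V k" by blast
          then show ?thesis by (intro UN_I[of k]) (auto simp: Reg_def)
        next
          case False
          then show ?thesis using y by (intro UN_I[of 0]) (auto simp: Reg_def)
        qed
      qed
    qed
    moreover have "Reg i \<inter> Reg j = {}" if "i < j" "j \<le> length C" for i j
      using that by (cases "i = 0") (auto simp: Reg_def V_def)
    then have "disjoint_family_on Reg {0..length C}"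
      unfolding disjoint_family_on_def by (metis atLeastAtMost_iff inf_commute linorder_neqE_nat)
    ultimately show ?thesis by (simp add: erasure_decoders_def)
  qed
  have opt: "optimal_regions P \<Theta> R T \<xi> n C Reg"
    unfolding optimal_regions_def
  proof (intro ballI conjI impI)
    fix m and y :: "'y list" assume m: "m \<in> {1..length C}" and y: "y \<in> words n"
    show "?r m y \<le> ?e * ?f m y" if "y \<in> Reg m"
      using that m by (auto simp: Reg_def V_def U split: if_splits)
    show "?e * ?f m y \<le> ?r m y" if "y \<notin> Reg m"
    proof (cases "y \<in> U m")
      case False
      then show ?thesis using y f0[of m y] r0[of m y] by (cases "?f m y = 0") (auto simp: U)
    next
      case True
      then have "\<exists>k\<in>{1..<m}. y \<in> U k"
        using that m by (auto simp: Reg_def V_def split: if_splits)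
      then obtain k where k: "1 \<le> k" "k < m" "y \<in> U k" by auto
      have e1: "?e \<le> 1" using RT by simp
      \<comment> \<open>The score of \<open>m\<close> occurs in the rival sum of \<open>k\<close>
        and vice versa; the chain passes through both sums.\<close>
      have "?f m y \<le> ?r k y"
        unfolding rival_score_def by (rule member_le_sum) (use m k f0 in auto)
      also have "\<dots> \<le> ?e * ?f k y" using k U by simp
      also have "\<dots> \<le> ?f k y" using mult_right_mono[OF e1 f0[of k y]] by simp
      also have "\<dots> \<le> ?r m y"
        unfolding rival_score_def by (rule member_le_sum) (use m k f0 in auto)
      finally have "?f m y \<le> ?r m y" .
      moreover have "?e * ?f m y \<le> ?f m y" using mult_right_mono[OF e1 f0[of m y]] by simp
      ultimately show ?thesis by linarith
    qed
  qed
  show ?thesis by (rule that[OF part opt])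
qed

text \<open>The disjoint optimal decoder is one candidate in the infimum. The remaining work is
  boundedness, without which real infima and suprema say nothing.\<close>

lemma K_le_minimal_risk:
  fixes P :: "'t \<Rightarrow> 'x::finite \<Rightarrow> 'y::finite pmf"
  assumes RT: "0 \<le> R" "0 \<le> T" and ne: "\<Theta> \<noteq> {}"
  shows "K P \<Theta> R T \<xi> n C \<le> minimal_risk P \<Theta> R T \<xi> n C"
proof -
  have K: "K P \<Theta> R T \<xi> n C =
      (INF Reg\<in>erasure_decoders n (length C). SUP \<theta>\<in>\<Theta>. weight P R T \<xi> n \<theta> * Lagrangian P T \<theta> n C Reg)"
    unfolding K_def weight_def by (simp add: exp_minus divide_inverse mult.commute)
  have nonneg: "0 \<le> weight P R T \<xi> n \<theta> * Lagrangian P T \<theta> n C Reg" for \<theta> and Reg :: "nat \<Rightarrow> 'y list set"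
    unfolding Lagrangian_def by (simp add: prob_E1_nonneg prob_E2_nonneg)
  obtain B where B: "0 < B" "\<And>\<theta>. weight P R T \<xi> n \<theta> \<le> B"
    using weight_bounded[OF RT] by blast
  have sup0: "0 \<le> (SUP \<theta>\<in>\<Theta>. weight P R T \<xi> n \<theta> * Lagrangian P T \<theta> n C Reg)" for Reg
  proof -
    obtain \<theta> where th: "\<theta> \<in> \<Theta>" using ne by blast
    \<comment> \<open>All likelihoods are replaced by 1, which bounds the Lagrangian uniformly in
      the parameter.\<close>
    define L where "L = 1 / real (length C) * (\<Sum>m\<in>{1..length C}. \<Sum>y\<in>words n \<inter> Reg m.
        \<Sum>m'\<in>{1..length C} - {m}. 1) + exp (- real n * T) * (1 / real (length C) *
        (\<Sum>m\<in>{1..length C}. \<Sum>y\<in>words n - Reg m. 1))"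
    have "Lagrangian P T \<theta> n C Reg \<le> L" for \<theta>
      unfolding Lagrangian_def prob_E1_def prob_E2_def L_def
      by (intro add_mono mult_left_mono sum_mono block_prob_le_1) auto
    moreover have "0 \<le> Lagrangian P T \<theta> n C Reg" for \<theta>
      unfolding Lagrangian_def by (simp add: prob_E1_nonneg prob_E2_nonneg)
    ultimately have "weight P R T \<xi> n \<theta> * Lagrangian P T \<theta> n C Reg \<le> B * L" for \<theta>
      using B by (intro mult_mono) (auto intro: less_imp_le)
    then show ?thesis
      by (intro cSUP_upper2[OF bdd_aboveI2 th nonneg])
  qed
  obtain Reg where Reg: "Reg \<in> erasure_decoders n (length C)" "optimal_regions P \<Theta> R T \<xi> n C Reg"
    using exists_optimal_decoder[OF RT ne] by blast
  have "K P \<Theta> R T \<xi> n C \<le> (SUP \<theta>\<in>\<Theta>. weight P R T \<xi> n \<theta> * Lagrangian P T \<theta> n C Reg)"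
    unfolding K by (rule cINF_lower[OF bdd_belowI2[OF sup0] Reg(1)])
  also have "\<dots> \<le> minimal_risk P \<Theta> R T \<xi> n C"
    using Lagrangian_le_minimal_risk[OF RT _ Reg(2)] ne by (intro cSUP_least) auto
  finally show ?thesis .
qed

section \<open>The average over the ensemble\<close>

lemma finite_set_code_ensemble [simp]: "finite (set_pmf (code_ensemble R n :: 'x::finite list list pmf))"
  unfolding code_ensemble_def by (intro finite_set_replicate_pmf) simp

lemma code_ensemble_support:
  assumes "C \<in> set_pmf (code_ensemble R n :: 'x::finite list list pmf)"
  shows "length C = num_messages R n" "x \<in> set C \<Longrightarrow> length x = n"
  using assms set_pmf_of_set[OF words_nonempty finite_words, where 'a1 = 'x and n1 = n]
  by (auto simp: code_ensemble_def set_replicate_pmf in_lists_conv_set words_def)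

lemma code_average_mono:
  assumes "\<And>C. C \<in> set_pmf (code_ensemble R n) \<Longrightarrow> f C \<le> g C"
  shows "code_average R n f \<le> code_average R n g"
  unfolding code_average_def by (intro expectation_mono_finite assms) simp_all

lemma code_average_sum:
  "code_average R n (\<lambda>C. \<Sum>i\<in>I. f i C) = (\<Sum>i\<in>I. code_average R n (f i))"
  unfolding code_average_def
  by (intro Bochner_Integration.integral_sum integrable_measure_pmf_finite) simp

lemma code_average_cmult: "code_average R n (\<lambda>C. c * f C) = c * code_average R n f"
  unfolding code_average_def by simp

text \<open>Rounding up adds less than 1, so the number of rivals stays below the nominal code
  size.\<close>

lemma num_messages_bounds:
  assumes "0 \<le> R"
  shows "1 \<le> num_messages R n" "real (num_messages R n) - 1 \<le> exp (real n * R)"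
proof -
  have "1 \<le> exp (real n * R)" using assms by simp
  then have "1 \<le> \<lceil>exp (real n * R)\<rceil>" by linarith
  then show "1 \<le> num_messages R n" "real (num_messages R n) - 1 \<le> exp (real n * R)"
    unfolding num_messages_def by linarith+
qed

text \<open>Messages are counted from 1, list entries from 0.\<close>

lemma sum_rivals_eq_sum_list:
  fixes \<phi> :: "'a \<Rightarrow> real"
  assumes m: "m \<in> {1..length C}"
  shows "(\<Sum>m'\<in>{1..length C} - {m}. \<phi> (C ! (m' - 1))) =
    sum_list (map \<phi> (take (m - 1) C @ drop (Suc (m - 1)) C))"
proof -
  have i: "m - 1 < length C" using m by auto
  have "sum_list (map \<phi> C) = (\<Sum>i<length C. \<phi> (C ! i))"
    by (simp add: sum_list_sum_nth atLeast0LessThan)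
  also have "\<dots> = (\<Sum>m'\<in>{1..length C}. \<phi> (C ! (m' - 1)))"
    by (rule sum.reindex_bij_witness[of _ "\<lambda>m. m - 1" Suc]) auto
  also have "\<dots> = \<phi> (C ! (m - 1)) + (\<Sum>m'\<in>{1..length C} - {m}. \<phi> (C ! (m' - 1)))"
    using m by (subst sum.remove[of _ m]) auto
  finally have "sum_list (map \<phi> C) =
      \<phi> (C ! (m - 1)) + (\<Sum>m'\<in>{1..length C} - {m}. \<phi> (C ! (m' - 1)))" .
  moreover have "sum_list (map \<phi> C) =
      sum_list (map \<phi> (take (m - 1) C @ C ! (m - 1) # drop (Suc (m - 1)) C))"
    using id_take_nth_drop[OF i] by simp
  ultimately show ?thesis by simp
qed

text \<open>On nonnegative reals the minimum is subadditive in each argument.\<close>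

lemma min_sum_le:
  fixes f g :: "'a \<Rightarrow> real"
  assumes fin: "finite A" and nn: "\<And>i. 0 \<le> f i" "\<And>i. 0 \<le> g i"
  shows "min (\<Sum>i\<in>A. f i) (\<Sum>j\<in>A. g j) \<le> (\<Sum>i\<in>A. \<Sum>j\<in>A. min (f i) (g j))"
proof -
  have sub: "min (a + b) c \<le> min a c + min b c" if "0 \<le> a" "0 \<le> b" "0 \<le> c" for a b c :: real
    using that by (auto simp: min_def)
  have L: "min (\<Sum>i\<in>A. f i) c \<le> (\<Sum>i\<in>A. min (f i) c)" if "0 \<le> c" "\<And>i. 0 \<le> f i" for f :: "'a \<Rightarrow> real" and c
    using fin
  proof (induction A)
    case (insert x F)
    then show ?case
      using sub[of "f x" "\<Sum>i\<in>F. f i" c] that by (simp add: sum_nonneg)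
  qed (use that in simp)
  have "min (\<Sum>i\<in>A. f i) (\<Sum>j\<in>A. g j) \<le> (\<Sum>i\<in>A. min (f i) (\<Sum>j\<in>A. g j))"
    by (intro L sum_nonneg nn)
  also have "\<dots> \<le> (\<Sum>i\<in>A. \<Sum>j\<in>A. min (f i) (g j))"
    using L[of "f _" g] nn by (intro sum_mono) (simp add: min.commute)
  finally show ?thesis .
qed

text \<open>One summand of the risk after both scores are expanded over parameters, without the
  factor 2. Position \<open>i\<close> belongs to message \<open>i + 1\<close>.\<close>

definition pair_risk ::
  "('t \<Rightarrow> 'x::finite \<Rightarrow> 'y::finite pmf) \<Rightarrow> real \<Rightarrow> real \<Rightarrow> real \<Rightarrow> nat \<Rightarrow> 't \<Rightarrow> 't \<Rightarrow>
     'x list list \<Rightarrow> nat \<Rightarrow> 'y list \<Rightarrow> real" where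
  "pair_risk P R T \<xi> n \<theta> \<theta>' C i y =
     min (exp (- real n * T) * weight P R T \<xi> n \<theta> * block_prob P \<theta> (C ! i) y)
       (weight P R T \<xi> n \<theta>' *
          sum_list (map (\<lambda>x. block_prob P \<theta>' x y) (take i C @ drop (Suc i) C)))"

text \<open>The random coding bound is used with the \<open>s\<close> and \<open>\<rho>\<close> that
  \<open>xi_star_pair_sum\<close> provides for this pair. Summed over output words it contains the
  \<open>n\<close>-th power of \<open>pair_sum\<close>, whose exponent cancels the weights, the rate
  and the threshold.\<close>

lemma average_pair_risk_le:
  fixes P :: "'t \<Rightarrow> 'x::finite \<Rightarrow> 'y::finite pmf"
  assumes RT: "0 \<le> R" "0 \<le> T" and th: "\<theta> \<in> \<Theta>" "\<theta>' \<in> \<Theta>" and eps: "0 < \<epsilon>"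
    and xi: "\<xi> \<le> xi_star P \<Theta> R T" and i: "i < num_messages R n"
  shows "(\<Sum>y\<in>words n. code_average R n (\<lambda>C. pair_risk P R T \<xi> n \<theta> \<theta>' C i y))
    \<le> exp (real n * (\<epsilon> * ln (real CARD('y))))"
proof -
  obtain s \<rho> where s: "0 \<le> s" "s \<le> \<rho>" "\<rho> \<le> 1" and Z: "pair_sum P \<theta> \<theta>' s \<rho> \<le>
     exp (- ((xi_star P \<Theta> R T - \<epsilon>) * ((1 - s) * E1 P R T \<theta> + s * E1 P R T \<theta>') + \<rho> * R + s * T))"
    using xi_star_pair_sum[OF RT th eps] by blast
  define e where "e = E1 P R T \<theta>"
  define e' where "e' = E1 P R T \<theta>'"
  define D where "D = (1 - s) * e + s * e'"
  define L where "L = ln (real CARD('y))"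
  define x where "x = xi_star P \<Theta> R T"
  define a where "a = exp (- real n * T) * weight P R T \<xi> n \<theta>"
  define b where "b = weight P R T \<xi> n \<theta>'"
  have D: "0 \<le> D" "D \<le> L"
  proof -
    show "0 \<le> D" unfolding D_def e_def e'_def
      using s E1_bounds(1)[OF RT] by (intro add_nonneg_nonneg mult_nonneg_nonneg) auto
    have "D \<le> (1 - s) * L + s * L" unfolding D_def e_def e'_def L_def
      using s E1_bounds(2)[OF RT] by (intro add_mono mult_left_mono) auto
    then show "D \<le> L" by (simp add: algebra_simps)
  qed
  \<comment> \<open>The threshold in the weight is cancelled for the sent codeword, but stays in
    \<open>b\<close> and produces the term \<open>s * T\<close>.\<close>
  have a: "a = exp (real n * (\<xi> * e))"
    by (simp add: a_def weight_def e_def exp_add [symmetric] algebra_simps)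
  have b: "b = exp (real n * (\<xi> * e' + T))" by (simp add: b_def weight_def e'_def)
  define A where "A y = (\<Prod>i<n. avg_pow P (1 - s) \<theta> (y ! i))" for y
  define B where "B y = rpow (\<Prod>i<n. avg_pow P (s / \<rho>) \<theta>' (y ! i)) \<rho>" for y
  have "(\<Sum>y\<in>words n. code_average R n (\<lambda>C. pair_risk P R T \<xi> n \<theta> \<theta>' C i y)) \<le>
      (\<Sum>y\<in>words n. a powr (1 - s) * b powr s * A y * (exp (real n * R) powr \<rho> * B y))"
  proof (intro sum_mono)
    fix y :: "'y list"
    show "code_average R n (\<lambda>C. pair_risk P R T \<xi> n \<theta> \<theta>' C i y)
        \<le> a powr (1 - s) * b powr s * A y * (exp (real n * R) powr \<rho> * B y)"
      unfolding code_average_def code_ensemble_def pair_risk_def A_def B_def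
        expectation_words_block_prob [symmetric] a_def [symmetric] b_def [symmetric]
      using num_messages_bounds[OF RT(1), of n] RT s i
      by (intro random_coding_bound) (auto simp: a b)
  qed
  also have "\<dots> = a powr (1 - s) * b powr s * exp (real n * R) powr \<rho> * (\<Sum>y\<in>words n. A y * B y)"
    by (simp add: sum_distrib_left mult_ac)
  also have "(\<Sum>y\<in>words n. A y * B y) = pair_sum P \<theta> \<theta>' s \<rho> ^ n"
    unfolding A_def B_def by (rule sum_words_pair_sum)
  also have "a powr (1 - s) * b powr s * exp (real n * R) powr \<rho> * pair_sum P \<theta> \<theta>' s \<rho> ^ n \<le>
      a powr (1 - s) * b powr s * exp (real n * R) powr \<rho> * exp (- ((x - \<epsilon>) * D + \<rho> * R + s * T)) ^ n"
    using Z by (intro mult_left_mono power_mono)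
      (auto simp: pair_sum_def D_def e_def e'_def x_def intro!: sum_nonneg)
  also have "\<dots> = exp (real n * ((\<xi> - x) * D + \<epsilon> * D))"
    by (simp add: a b powr_def exp_of_nat_mult [symmetric] exp_add [symmetric] D_def algebra_simps)
  also have "\<dots> \<le> exp (real n * (\<epsilon> * L))"
  proof -
    \<comment> \<open>This is where \<open>\<xi> \<le> \<xi>*\<close> enters.\<close>
    have "(\<xi> - x) * D \<le> 0" using xi D by (simp add: x_def mult_nonpos_nonneg)
    moreover have "\<epsilon> * D \<le> \<epsilon> * L" using D eps by simp
    ultimately show ?thesis by (simp add: mult_left_mono)
  qed
  finally show ?thesis by (simp add: L_def)
qed

text \<open>Both arguments of the minimum acquire the same factor 2, which comes out;
  \<open>min_sum_le\<close> then leaves a sum over pairs of parameters.\<close>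

lemma minimal_risk_le_pair_risk:
  fixes P :: "'t \<Rightarrow> 'x::finite \<Rightarrow> 'y::finite pmf"
  assumes fin: "finite \<Theta>'" and C: "\<And>x. x \<in> set C \<Longrightarrow> length x = n"
    and score: "\<And>x y. length x = n \<Longrightarrow>
      score P \<Theta> R T \<xi> n x y \<le> 2 * (\<Sum>\<theta>\<in>\<Theta>'. weight P R T \<xi> n \<theta> * block_prob P \<theta> x y)"
  shows "minimal_risk P \<Theta> R T \<xi> n C \<le> 1 / real (length C) * (\<Sum>m\<in>{1..length C}. \<Sum>\<theta>\<in>\<Theta>'. \<Sum>\<theta>'\<in>\<Theta>'.
    2 * (\<Sum>y\<in>words n. pair_risk P R T \<xi> n \<theta> \<theta>' C (m - 1) y))"
proof -
  let ?e = "exp (- real n * T)" and ?w = "weight P R T \<xi> n"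
  have bound: "min (?e * score P \<Theta> R T \<xi> n (codeword C m) y) (rival_score P \<Theta> R T \<xi> n C m y)
      \<le> (\<Sum>\<theta>\<in>\<Theta>'. \<Sum>\<theta>'\<in>\<Theta>'. 2 * pair_risk P R T \<xi> n \<theta> \<theta>' C (m - 1) y)"
    if m: "m \<in> {1..length C}" for m and y :: "'y list"
  proof -
    define f where "f \<theta> = ?e * ?w \<theta> * block_prob P \<theta> (C ! (m - 1)) y" for \<theta>
    define g where "g \<theta> = ?w \<theta> *
      sum_list (map (\<lambda>x. block_prob P \<theta> x y) (take (m - 1) C @ drop (Suc (m - 1)) C))" for \<theta>
    have len: "length (codeword C m') = n" if "m' \<in> {1..length C}" for m'
      using that by (intro C nth_mem) auto
    have "?e * score P \<Theta> R T \<xi> n (codeword C m) y \<le>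
        ?e * (2 * (\<Sum>\<theta>\<in>\<Theta>'. ?w \<theta> * block_prob P \<theta> (codeword C m) y))"
      using m by (intro mult_left_mono score len) auto
    also have "\<dots> = 2 * (\<Sum>\<theta>\<in>\<Theta>'. f \<theta>)"
      by (simp add: f_def sum_distrib_left mult_ac)
    finally have 1: "?e * score P \<Theta> R T \<xi> n (codeword C m) y \<le> 2 * (\<Sum>\<theta>\<in>\<Theta>'. f \<theta>)" .
    have "rival_score P \<Theta> R T \<xi> n C m y \<le>
        (\<Sum>m'\<in>{1..length C} - {m}. 2 * (\<Sum>\<theta>\<in>\<Theta>'. ?w \<theta> * block_prob P \<theta> (codeword C m') y))"
      unfolding rival_score_def by (intro sum_mono score len) auto
    also have "\<dots> = 2 * (\<Sum>\<theta>\<in>\<Theta>'. ?w \<theta> * (\<Sum>m'\<in>{1..length C} - {m}. block_prob P \<theta> (codeword C m') y))"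
      by (subst sum_distrib_left [symmetric], subst sum.swap) (simp add: sum_distrib_left)
    also have "\<dots> = 2 * (\<Sum>\<theta>\<in>\<Theta>'. g \<theta>)"
      unfolding g_def using sum_rivals_eq_sum_list[OF m, of "\<lambda>x. block_prob P _ x y"] by simp
    finally have 2: "rival_score P \<Theta> R T \<xi> n C m y \<le> 2 * (\<Sum>\<theta>\<in>\<Theta>'. g \<theta>)" .
    have "min (?e * score P \<Theta> R T \<xi> n (codeword C m) y) (rival_score P \<Theta> R T \<xi> n C m y)
        \<le> 2 * min (\<Sum>\<theta>\<in>\<Theta>'. f \<theta>) (\<Sum>\<theta>\<in>\<Theta>'. g \<theta>)"
      using 1 2 by (auto simp: min_def)
    also have "\<dots> \<le> 2 * (\<Sum>\<theta>\<in>\<Theta>'. \<Sum>\<theta>'\<in>\<Theta>'. min (f \<theta>) (g \<theta>'))"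
    proof (intro mult_left_mono min_sum_le fin)
      show "0 \<le> f \<theta>" for \<theta> by (simp add: f_def)
      show "0 \<le> g \<theta>" for \<theta> unfolding g_def by (intro mult_nonneg_nonneg sum_list_nonneg) auto
    qed simp
    also have "\<dots> = (\<Sum>\<theta>\<in>\<Theta>'. \<Sum>\<theta>'\<in>\<Theta>'. 2 * pair_risk P R T \<xi> n \<theta> \<theta>' C (m - 1) y)"
      by (simp add: pair_risk_def f_def g_def sum_distrib_left)
    finally show ?thesis .
  qed
  have "minimal_risk P \<Theta> R T \<xi> n C \<le> 1 / real (length C) * (\<Sum>m\<in>{1..length C}. \<Sum>y\<in>words n.
      \<Sum>\<theta>\<in>\<Theta>'. \<Sum>\<theta>'\<in>\<Theta>'. 2 * pair_risk P R T \<xi> n \<theta> \<theta>' C (m - 1) y)"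
    unfolding minimal_risk_def by (intro mult_left_mono sum_mono bound) auto
  also have "(\<Sum>m\<in>{1..length C}. \<Sum>y\<in>words n.
      \<Sum>\<theta>\<in>\<Theta>'. \<Sum>\<theta>'\<in>\<Theta>'. 2 * pair_risk P R T \<xi> n \<theta> \<theta>' C (m - 1) y) =
    (\<Sum>m\<in>{1..length C}. \<Sum>\<theta>\<in>\<Theta>'. \<Sum>\<theta>'\<in>\<Theta>'. 2 * (\<Sum>y\<in>words n. pair_risk P R T \<xi> n \<theta> \<theta>' C (m - 1) y))"
    unfolding sum_distrib_left
    by (intro sum.cong refl trans[OF sum.swap] sum.swap)
  finally show ?thesis .
qed

text \<open>The bound for a pair does not depend on the message, so averaging over messages cancels;
  the number of pairs gives the polynomial factor.\<close>

lemma average_minimal_risk_le: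
  fixes P :: "'t \<Rightarrow> 'x::finite \<Rightarrow> 'y::finite pmf"
  assumes RT: "0 \<le> R" "0 \<le> T" and ne: "\<Theta> \<noteq> {}" and eps: "0 < \<epsilon>"
    and xi: "\<xi> \<le> xi_star P \<Theta> R T"
  shows "code_average R n (minimal_risk P \<Theta> R T \<xi> n)
    \<le> 2 * real (n + 1) ^ (2 * CARD('x \<times> 'y)) * exp (real n * (\<epsilon> * ln (real CARD('y))))"
proof -
  obtain \<Theta>' where fin: "finite \<Theta>'" and sub: "\<Theta>' \<subseteq> \<Theta>"
    and card: "card \<Theta>' \<le> (n + 1) ^ CARD('x \<times> 'y)"
    and score: "\<And>(x :: 'x list) (y :: 'y list). length x = n \<Longrightarrow>
      score P \<Theta> R T \<xi> n x y \<le> 2 * (\<Sum>\<theta>\<in>\<Theta>'. weight P R T \<xi> n \<theta> * block_prob P \<theta> x y)"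
    using score_le_sum[OF RT ne, where P = P and \<xi> = \<xi> and n = n] by blast
  define M where "M = num_messages R n"
  define X where "X = exp (real n * (\<epsilon> * ln (real CARD('y))))"
  have M: "0 < M" using num_messages_bounds(1)[OF RT(1), of n] by (simp add: M_def)
  have "code_average R n (minimal_risk P \<Theta> R T \<xi> n) \<le> code_average R n (\<lambda>C. 1 / real M *
      (\<Sum>m\<in>{1..M}. \<Sum>\<theta>\<in>\<Theta>'. \<Sum>\<theta>'\<in>\<Theta>'. 2 * (\<Sum>y\<in>words n. pair_risk P R T \<xi> n \<theta> \<theta>' C (m - 1) y)))"
  proof (rule code_average_mono)
    fix C :: "'x list list" assume "C \<in> set_pmf (code_ensemble R n)"
    note C = code_ensemble_support[OF this]
    show "minimal_risk P \<Theta> R T \<xi> n C \<le> 1 / real M * (\<Sum>m\<in>{1..M}. \<Sum>\<theta>\<in>\<Theta>'. \<Sum>\<theta>'\<in>\<Theta>'.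
        2 * (\<Sum>y\<in>words n. pair_risk P R T \<xi> n \<theta> \<theta>' C (m - 1) y))"
      using minimal_risk_le_pair_risk[OF fin C(2) score] unfolding M_def C(1) [symmetric] by simp
  qed
  also have "\<dots> = 1 / real M * (\<Sum>m\<in>{1..M}. \<Sum>\<theta>\<in>\<Theta>'. \<Sum>\<theta>'\<in>\<Theta>'.
      2 * (\<Sum>y\<in>words n. code_average R n (\<lambda>C. pair_risk P R T \<xi> n \<theta> \<theta>' C (m - 1) y)))"
    by (simp only: code_average_cmult code_average_sum)
  also have "\<dots> \<le> 1 / real M * (\<Sum>m\<in>{1..M}. \<Sum>\<theta>\<in>\<Theta>'. \<Sum>\<theta>'\<in>\<Theta>'. 2 * X)"
    unfolding X_def using sub
    by (intro mult_left_mono sum_mono average_pair_risk_le[OF RT _ _ eps xi]) (auto simp: M_def)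
  also have "\<dots> = 2 * (real (card \<Theta>'))\<^sup>2 * X"
    using M by (simp add: power2_eq_square)
  also have "\<dots> \<le> 2 * (real ((n + 1) ^ CARD('x \<times> 'y)))\<^sup>2 * X"
    using of_nat_mono[OF card] by (intro mult_right_mono mult_left_mono power_mono) (simp_all add: X_def)
  also have "\<dots> = 2 * real (n + 1) ^ (2 * CARD('x \<times> 'y)) * X"
    by (simp only: of_nat_power power_mult [symmetric] mult.commute[of _ 2])
  finally show ?thesis by (simp add: X_def)
qed

section \<open>From finite-length bounds to exponential rates\<close>

text \<open>The polynomial factor disappears after taking logarithms and dividing by
  \<open>n\<close>, and \<open>\<epsilon>\<close> is arbitrary.\<close>

lemma limsup_log_rate_le:
  assumes B: "0 \<le> B" and a: "\<And>\<epsilon> n. 0 < \<epsilon> \<Longrightarrow> a n \<le> 2 * real (n + 1) ^ k * exp (real n * (c + \<epsilon> * B))"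
  shows "limsup (log_rate a) \<le> ereal c"
proof (rule ereal_le_epsilon2)
  fix \<delta> :: real assume \<delta>: "0 < \<delta>"
  \<comment> \<open>The added 1 covers \<open>B = 0\<close>, which occurs for a one-letter output
    alphabet.\<close>
  define \<epsilon> where "\<epsilon> = \<delta> / (B + 1)"
  have eps: "0 < \<epsilon>" "\<epsilon> * B \<le> \<delta>" using \<delta> B by (auto simp: \<epsilon>_def field_simps)
  define u where "u n = (ln 2 + real k * ln (real (n + 1))) / real n + (c + \<delta>)" for n
  have "log_rate a n \<le> ereal (u n)" if n: "0 < n" for n
  proof (cases "a n \<le> 0")
    case True
    then show ?thesis using n by (simp add: log_rate_def eln_def)
  next
    case False
    have "ln (a n) \<le> ln (2 * real (n + 1) ^ k * exp (real n * (c + \<epsilon> * B)))"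
      using False a[OF eps(1), of n] by (intro ln_mono) auto
    also have "\<dots> = ln 2 + real k * ln (real (n + 1)) + real n * (c + \<epsilon> * B)"
      by (simp add: ln_mult ln_realpow)
    also have "\<dots> \<le> ln 2 + real k * ln (real (n + 1)) + real n * (c + \<delta>)"
      using eps by (simp add: mult_left_mono)
    finally have "ln (a n) / real n \<le> u n"
      using n by (simp add: u_def field_simps)
    then show ?thesis using False by (simp add: log_rate_def eln_def)
  qed
  then have "limsup (log_rate a) \<le> limsup (\<lambda>n. ereal (u n))"
    by (intro Limsup_mono eventually_mono[OF eventually_gt_at_top[of 0]])
  also have "u \<longlonglongrightarrow> c + \<delta>" unfolding u_def by real_asymp
  then have "limsup (\<lambda>n. ereal (u n)) = ereal (c + \<delta>)"
    by (intro lim_imp_Limsup) auto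
  finally show "limsup (log_rate a) \<le> ereal c + ereal \<delta>" by simp
qed

theorem theorem2:
  fixes P :: "'t \<Rightarrow> 'x::finite \<Rightarrow> 'y::finite pmf"
    and \<Theta> :: "'t set"
    and R T :: real
  assumes "\<Theta> \<noteq> {}" and "R \<ge> 0" and "T \<ge> 0"
  shows "(\<forall>\<xi>. \<xi> \<le> xi_star P \<Theta> R T \<longrightarrow>
            limsup (log_rate (\<lambda>n. code_average R n (K P \<Theta> R T \<xi> n))) \<le> 0)
    \<and> (\<forall>\<theta>\<in>\<Theta>.
         liminf (\<lambda>n. - log_rate (\<lambda>n. code_average R n (\<lambda>C.
             prob_E1 P \<theta> n C (universal_decoder P \<Theta> R T (xi_star P \<Theta> R T) n C))) n)
           \<ge> ereal (xi_star P \<Theta> R T * E1 P R T \<theta>)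
       \<and> liminf (\<lambda>n. - log_rate (\<lambda>n. code_average R n (\<lambda>C.
             prob_E2 P \<theta> n C (universal_decoder P \<Theta> R T (xi_star P \<Theta> R T) n C))) n)
           \<ge> ereal (xi_star P \<Theta> R T * E1 P R T \<theta> + T))"
proof (intro conjI allI impI ballI)
  note RT = assms(2,3) and ne = assms(1)
  let ?k = "2 * CARD('x \<times> 'y)" and ?L = "ln (real CARD('y))"
  have L: "0 \<le> ?L" by simp
  show "limsup (log_rate (\<lambda>n. code_average R n (K P \<Theta> R T \<xi> n))) \<le> 0" if "\<xi> \<le> xi_star P \<Theta> R T" for \<xi>
    unfolding zero_ereal_def
  proof (rule limsup_log_rate_le[OF L])
    fix \<epsilon> :: real and n assume eps: "0 < \<epsilon>"
    have "code_average R n (K P \<Theta> R T \<xi> n) \<le> code_average R n (minimal_risk P \<Theta> R T \<xi> n)"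
      by (intro code_average_mono K_le_minimal_risk RT ne)
    also have "\<dots> \<le> 2 * real (n + 1) ^ ?k * exp (real n * (\<epsilon> * ?L))"
      by (intro average_minimal_risk_le RT ne eps that)
    finally show "code_average R n (K P \<Theta> R T \<xi> n)
        \<le> 2 * real (n + 1) ^ ?k * exp (real n * (0 + \<epsilon> * ?L))" by simp
  qed
  fix \<theta> assume th: "\<theta> \<in> \<Theta>"
  define \<xi> where "\<xi> = xi_star P \<Theta> R T"
  define Reg where "Reg n C = universal_decoder P \<Theta> R T \<xi> n C" for n C
  \<comment> \<open>Common to both error events: a quantity dominated, after scaling by
    \<open>exp (real n * c)\<close>, by the weighted Lagrangian decays at rate at least
    \<open>c\<close>.\<close>
  have rate: "ereal c \<le> liminf (\<lambda>n. - log_rate (\<lambda>n. code_average R n (p n)) n)"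
    if p: "\<And>n C. exp (real n * c) * p n C \<le> weight P R T \<xi> n \<theta> * Lagrangian P T \<theta> n C (Reg n C)" for c p
  proof -
    have "limsup (log_rate (\<lambda>n. code_average R n (p n))) \<le> ereal (- c)"
    proof (rule limsup_log_rate_le[OF L])
      fix \<epsilon> :: real and n assume eps: "0 < \<epsilon>"
      have "p n C \<le> exp (- (real n * c)) * minimal_risk P \<Theta> R T \<xi> n C" for C
      proof -
        \<comment> \<open>The decoder enters through optimality alone, so overlapping regions at
          ties do no harm.\<close>
        have "exp (real n * c) * p n C \<le> minimal_risk P \<Theta> R T \<xi> n C"
          using p[of n C] Lagrangian_le_minimal_risk[OF RT th universal_decoder_optimal[OF RT ne], of P \<xi> n C]
          by (simp add: Reg_def)
        then show ?thesis by (simp add: exp_minus field_simps)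
      qed
      then have "code_average R n (p n) \<le> code_average R n (\<lambda>C. exp (- (real n * c)) * minimal_risk P \<Theta> R T \<xi> n C)"
        by (intro code_average_mono)
      also have "\<dots> = exp (- (real n * c)) * code_average R n (minimal_risk P \<Theta> R T \<xi> n)"
        by (rule code_average_cmult)
      also have "\<dots> \<le> exp (- (real n * c)) * (2 * real (n + 1) ^ ?k * exp (real n * (\<epsilon> * ?L)))"
        by (intro mult_left_mono average_minimal_risk_le RT ne eps) (auto simp: \<xi>_def)
      also have "\<dots> = 2 * real (n + 1) ^ ?k * exp (real n * (- c + \<epsilon> * ?L))"
        by (simp add: distrib_left exp_add right_diff_distrib exp_diff exp_minus divide_inverse)
      finally show "code_average R n (p n) \<le> 2 * real (n + 1) ^ ?k * exp (real n * (- c + \<epsilon> * ?L))" .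
    qed
    then have "- ereal (- c) \<le> - limsup (log_rate (\<lambda>n. code_average R n (p n)))"
      by (simp only: ereal_minus_le_minus)
    then show ?thesis by (simp add: ereal_Liminf_uminus)
  qed
  have "ereal (\<xi> * E1 P R T \<theta>) \<le> liminf (\<lambda>n. - log_rate (\<lambda>n. code_average R n (\<lambda>C. prob_E1 P \<theta> n C (Reg n C))) n)"
  proof (rule rate)
    fix n C
    \<comment> \<open>The multiplier of \<open>prob_E1\<close> in the Lagrangian cancels the
      threshold in the weight; \<open>prob_E2\<close> has no such multiplier and therefore gains
      \<open>T\<close>.\<close>
    have "exp (real n * (\<xi> * E1 P R T \<theta>)) = weight P R T \<xi> n \<theta> * exp (- real n * T)"
      by (simp add: weight_def exp_add [symmetric] algebra_simps)
    then show "exp (real n * (\<xi> * E1 P R T \<theta>)) * prob_E1 P \<theta> n C (Reg n C)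
        \<le> weight P R T \<xi> n \<theta> * Lagrangian P T \<theta> n C (Reg n C)"
      by (simp add: Lagrangian_def mult.assoc prob_E2_nonneg)
  qed
  then show "ereal (xi_star P \<Theta> R T * E1 P R T \<theta>) \<le> liminf (\<lambda>n. - log_rate (\<lambda>n. code_average R n (\<lambda>C.
      prob_E1 P \<theta> n C (universal_decoder P \<Theta> R T (xi_star P \<Theta> R T) n C))) n)"
    by (simp only: Reg_def \<xi>_def)
  have "ereal (\<xi> * E1 P R T \<theta> + T) \<le> liminf (\<lambda>n. - log_rate (\<lambda>n. code_average R n (\<lambda>C. prob_E2 P \<theta> n C (Reg n C))) n)"
    by (rule rate) (simp add: weight_def Lagrangian_def prob_E1_nonneg)
  then show "ereal (xi_star P \<Theta> R T * E1 P R T \<theta> + T) \<le> liminf (\<lambda>n. - log_rate (\<lambda>n. code_average R n (\<lambda>C.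
      prob_E2 P \<theta> n C (universal_decoder P \<Theta> R T (xi_star P \<Theta> R T) n C))) n)"
    by (simp only: Reg_def \<xi>_def)
qed

end
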